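(* Let $\mathbb{F}$ be a field and $P(\lambda)\in\mathbb{F}[\lambda]^{m\times n}_d$ with normal rank $r>0$, degree exactly $d$, and without finite or infinite eigenvalues (infinite with respect to $d$). Then: (i) If $P=L E R$ with $L\in\mathbb{F}[\lambda]^{m\times r}$, $E\in\mathbb{F}[\lambda]^{r\times r}$, $R\in\mathbb{F}[\lambda]^{r\times n}$, where the columns of $L$ form a minimal basis of $\mathcal{C}ol(P)$, the rows of $R$ form a minimal basis of $\mathcal{R}ow(P)$ and the invariant polynomials of $E$ are those of $P$, then the rows of $\widehat R=ER$ form a minimal basis of $\mathcal{R}ow(P)$, the columns of $\widehat L=LE$ form a minimal basis of $\mathcal{C}ol(P)$, and $\deg(L_{*i})+\deg(\widehat R_{i*})=\deg(\widehat L_{*i})+\deg(R_{i*})=d$ for $i=1,\dots,r$. (ii) If $P=LR$ with $L\in\mathbb{F}[\lambda]^{m\times r}$, $R\in\mathbb{F}[\lambda]^{r\times n}$, where the columns of $L$ form a minimal basis of $\mathcal{C}ol(P)$ and the invariant polynomials of $R$ are those of $P$, then the rows of $R$ form a minimal basis of $\mathcal{R}ow(P)$ and $\deg(L_{*i})+\deg(R_{i*})=d$ for $i=1,\dots,r$. (iii) If $P=LR$ with $L\in\mathbb{F}[\lambda]^{m\times r}$, $R\in\mathbb{F}[\lambda]^{r\times n}$, where the rows of $R$ form a minimal basis of $\mathcal{R}ow(P)$ and the invariant polynomials of $L$ are those of $P$, then the columns of $L$ form a minimal basis of $\mathcal{C}ol(P)$ and $\deg(L_{*i})+\deg(R_{i*})=d$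 for $i=1,\dots,r$.
   Context: $\mathbb{F}[\lambda]^{m\times n}_d$: $m\times n$ polynomial matrices of degree at most $d$ (degree = maximum degree of entries, $\deg0=-\infty$). $L_{*i}$: $i$th column; $R_{i*}$: $i$th row. Normal rank: rank over $\mathbb{F}(\lambda)$. $\mathcal{C}ol(P)=\{Pv:v\in\mathbb{F}(\lambda)^{n}\}$, $\mathcal{R}ow(P)=\{wP:w\in\mathbb{F}(\lambda)^{1\times m}\}$. A minimal basis of a subspace of $\mathbb{F}(\lambda)^k$ is a polynomial basis with minimal sum of degrees among polynomial bases. Invariant polynomials: the monic nonzero diagonal entries $e_1|\cdots|e_r$ of the Smith form. A finite eigenvalue is a root in $\overline{\mathbb{F}}$ of an invariant polynomial; $P$ has an infinite eigenvalue (with respect to $d$) if $0$ is a finite eigenvalue of $\lambda^dP(1/\lambda)$. *)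

theory Defs
  imports "Jordan_Normal_Form.DL_Rank" "HOL-Computational_Algebra.Fraction_Field"
    "HOL-Computational_Algebra.Polynomial"
begin

definition to_frac :: "'a::field poly mat \<Rightarrow> 'a poly fract mat" where
  "to_frac A = map_mat (\<lambda>p. Fract p 1) A"

definition normal_rank :: "'a::field poly mat \<Rightarrow> nat" where
  "normal_rank A = vec_space.rank (dim_row A) (to_frac A)"

text \<open>Column space Col(A) = { A v : v in F(lambda)^n } and row space Row(A) = { w A };
  row vectors w A are represented as the column vectors A^T w^T.\<close>
definition col_space :: "'a::field poly mat \<Rightarrow> 'a poly fract vec set" where
  "col_space A = {to_frac A *\<^sub>v v | v. v \<in> carrier_vec (dim_col A)}"

definition row_space :: "'a::field poly mat \<Rightarrow> 'a poly fract vec set" where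
  "row_space A = col_space (transpose_mat A)"

text \<open>Degree of a polynomial matrix / vector: maximum degree of its entries
  (only used for nonzero objects below).\<close>
definition mat_degree :: "'a::field poly mat \<Rightarrow> nat" where
  "mat_degree A = Max ({degree (A $$ (i,j)) | i j. i < dim_row A \<and> j < dim_col A} \<union> {0})"

definition col_deg :: "'a::field poly mat \<Rightarrow> nat \<Rightarrow> nat" where
  "col_deg A j = Max ({degree (A $$ (i,j)) | i. i < dim_row A} \<union> {0})"

definition row_deg :: "'a::field poly mat \<Rightarrow> nat \<Rightarrow> nat" where
  "row_deg A i = col_deg (transpose_mat A) i"

definition poly_col_basis :: "'a::field poly fract vec set \<Rightarrow> 'a poly mat \<Rightarrow> bool" where
  "poly_col_basis S B \<longleftrightarrow>
     (\<forall>v \<in> carrier_vec (dim_col B). to_frac B *\<^sub>v v = 0\<^sub>v (dim_row B) \<longrightarrow> v = 0\<^sub>v (dim_col B))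
     \<and> col_space B = S"

definition col_degsum :: "'a::field poly mat \<Rightarrow> nat" where
  "col_degsum B = (\<Sum>j < dim_col B. col_deg B j)"

definition minimal_col_basis :: "'a::field poly mat \<Rightarrow> 'a poly fract vec set \<Rightarrow> bool" where
  "minimal_col_basis B S \<longleftrightarrow> poly_col_basis S B \<and>
     (\<forall>B'. poly_col_basis S B' \<longrightarrow> col_degsum B \<le> col_degsum B')"

definition minimal_row_basis :: "'a::field poly mat \<Rightarrow> 'a poly fract vec set \<Rightarrow> bool" where
  "minimal_row_basis R S \<longleftrightarrow> minimal_col_basis (transpose_mat R) S"

definition unimodular :: "'a::field poly mat \<Rightarrow> bool" where
  "unimodular U \<longleftrightarrow> U \<in> carrier_mat (dim_row U) (dim_row U) \<and> is_unit (det U)"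

definition smith_diag :: "'a::field poly mat \<Rightarrow> 'a poly list \<Rightarrow> bool" where
  "smith_diag S es \<longleftrightarrow>
     length es \<le> min (dim_row S) (dim_col S) \<and>
     (\<forall>i < dim_row S. \<forall>j < dim_col S. i \<noteq> j \<longrightarrow> S $$ (i,j) = 0) \<and>
     (\<forall>i < length es. S $$ (i,i) = es ! i \<and> es ! i \<noteq> 0 \<and> lead_coeff (es ! i) = 1) \<and>
     (\<forall>i. length es \<le> i \<and> i < min (dim_row S) (dim_col S) \<longrightarrow> S $$ (i,i) = 0) \<and>
     (\<forall>i. Suc i < length es \<longrightarrow> es ! i dvd es ! Suc i)"

definition invariant_polys :: "'a::field poly mat \<Rightarrow> 'a poly list \<Rightarrow> bool" where
  "invariant_polys P es \<longleftrightarrow>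
     (\<exists>U V. U \<in> carrier_mat (dim_row P) (dim_row P) \<and> unimodular U \<and>
            V \<in> carrier_mat (dim_col P) (dim_col P) \<and> unimodular V \<and>
            smith_diag (U * P * V) es)"

definition same_invariant_polys :: "'a::field poly mat \<Rightarrow> 'a poly mat \<Rightarrow> bool" where
  "same_invariant_polys A B \<longleftrightarrow> (\<exists>es. invariant_polys A es \<and> invariant_polys B es)"

text \<open>A finite eigenvalue is a root (in the algebraic closure of F) of an invariant
  polynomial.  Since invariant polynomials are monic, such a root exists iff some
  invariant polynomial has positive degree.\<close>
definition has_finite_eigenvalue :: "'a::field poly mat \<Rightarrow> bool" where
  "has_finite_eigenvalue P \<longleftrightarrow> (\<exists>es. invariant_polys P es \<and> (\<exists>e \<in> set es. degree e > 0))"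

text \<open>Entrywise reversal with respect to d: lambda^d p(1/lambda) for deg p \<le> d.\<close>
definition rev_poly :: "nat \<Rightarrow> 'a::field poly \<Rightarrow> 'a poly" where
  "rev_poly d p = (\<Sum>k\<le>d. monom (coeff p k) (d - k))"

definition rev_mat :: "nat \<Rightarrow> 'a::field poly mat \<Rightarrow> 'a poly mat" where
  "rev_mat d P = map_mat (rev_poly d) P"

definition has_infinite_eigenvalue :: "nat \<Rightarrow> 'a::field poly mat \<Rightarrow> bool" where
  "has_infinite_eigenvalue d P \<longleftrightarrow>
     (\<exists>es. invariant_polys (rev_mat d P) es \<and> (\<exists>e \<in> set es. poly e 0 = 0))"

end

theory Submission
  imports Defs
begin

text \<open>
  Let \<open>P = L R\<close> with inner dimension \<open>r\<close> equal to the rank. As \<open>P\<close> has no finite eigenvalues, its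
  Smith form has only units, so \<open>X P Y = 1\<close> for polynomial \<open>X\<close>, \<open>Y\<close>. Then \<open>X L\<close> and \<open>R Y\<close> are
  mutually inverse square matrices, so \<open>L\<close> is left and \<open>R\<close> is right invertible over the polynomials.
  If \<open>L\<close> is moreover a minimal basis, it is column reduced, and the predictable degree property gives
  \<open>deg L\<^sub>*\<^sub>i + deg R\<^sub>i\<^sub>* \<le> d\<close>. Hence the coefficient of \<open>\<lambda>\<^sup>d\<close> in \<open>P\<close> is the product of the leading
  column coefficient matrix of \<open>L\<close> and the matrix \<open>R\<^sub>0\<close> of the coefficients of \<open>R\<^sub>i\<^sub>*\<close> at
  \<open>d - deg L\<^sub>*\<^sub>i\<close>. It has rank \<open>r\<close> because there is no infinite eigenvalue, so \<open>R\<^sub>0\<close> has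
  independent rows: the degree bounds are equalities and \<open>R\<close> is row reduced. A right invertible, row
  reduced matrix is a minimal basis of its row space. The case of a minimal \<open>R\<close> follows by
  transposition, and (i) by grouping \<open>L E R\<close> in both ways.
\<close>

section \<open>Smith normal form\<close>

text \<open>The equivalence hidden in \<open>invariant_polys\<close>, isolated so that a Smith form
  can be reached by composing elementary transformations.\<close>

definition unimod_equiv :: "'a::field poly mat \<Rightarrow> 'a poly mat \<Rightarrow> bool" where
  "unimod_equiv A B \<longleftrightarrow>
     (\<exists>U V. U \<in> carrier_mat (dim_row A) (dim_row A) \<and> unimodular U \<and>
            V \<in> carrier_mat (dim_col A) (dim_col A) \<and> unimodular V \<and> B = U * A * V)"

lemma invariant_polys_iff: "invariant_polys P es \<longleftrightarrow> (\<exists>S. unimod_equiv P S \<and> smith_diag S es)"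
  unfolding invariant_polys_def unimod_equiv_def by blast

lemma unimodular_iff: "U \<in> carrier_mat n n \<Longrightarrow> unimodular U \<longleftrightarrow> is_unit (det U)"
  unfolding unimodular_def by auto

lemma unimodular_one [simp]: "unimodular (1\<^sub>m n)"
  by (simp add: unimodular_def)

lemma unimodular_mult:
  assumes "U \<in> carrier_mat n n" "V \<in> carrier_mat n n" "unimodular U" "unimodular V"
  shows "unimodular (U * V)"
  using assms by (simp add: unimodular_iff[of _ n] det_mult[of _ n] is_unit_mult_iff)

lemma unimodular_transpose:
  "U \<in> carrier_mat n n \<Longrightarrow> unimodular U \<Longrightarrow> unimodular (transpose_mat U)"
  by (simp add: unimodular_iff[of _ n] det_transpose)

text \<open>The adjugate is polynomial, so scaling it by the inverse of the unit
  \<open>det U\<close> gives a polynomial inverse.\<close>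

lemma unimodular_inverse:
  assumes "U \<in> carrier_mat n n" "unimodular U"
  obtains U' where "U' \<in> carrier_mat n n" "U * U' = 1\<^sub>m n" "U' * U = 1\<^sub>m n"
proof -
  from assms obtain c where c: "1 = det U * c" by (auto simp: unimodular_iff elim: dvdE)
  note a = adj_mat[OF assms(1)]
  have "U * (c \<cdot>\<^sub>m adj_mat U) = c \<cdot>\<^sub>m (U * adj_mat U)"
    by (rule mult_smult_distrib[OF assms(1) a(1)])
  also have "\<dots> = 1\<^sub>m n" unfolding a(2) using c by (auto simp: mult.commute)
  finally have 1: "U * (c \<cdot>\<^sub>m adj_mat U) = 1\<^sub>m n" .
  have "(c \<cdot>\<^sub>m adj_mat U) * U = c \<cdot>\<^sub>m (adj_mat U * U)"
    by (rule mult_smult_assoc_mat[OF a(1) assms(1)])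
  also have "\<dots> = 1\<^sub>m n" unfolding a(3) using c by (auto simp: mult.commute)
  finally show thesis using that[of "c \<cdot>\<^sub>m adj_mat U"] 1 a(1) by auto
qed

lemma unimod_equiv_dim:
  "unimod_equiv A B \<Longrightarrow> dim_row B = dim_row A \<and> dim_col B = dim_col A"
  unfolding unimod_equiv_def by auto

lemma unimod_equivI:
  assumes "A \<in> carrier_mat m n" "U \<in> carrier_mat m m" "unimodular U"
    "V \<in> carrier_mat n n" "unimodular V"
  shows "unimod_equiv A (U * A * V)"
  using assms(2-) unfolding unimod_equiv_def carrier_matD[OF assms(1)] by blast

lemma unimod_equiv_refl: "unimod_equiv A A"
  unfolding unimod_equiv_def
  by (rule exI[of _ "1\<^sub>m (dim_row A)"], rule exI[of _ "1\<^sub>m (dim_col A)"]) auto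

lemma unimod_equiv_trans:
  assumes "unimod_equiv A B" "unimod_equiv B C"
  shows "unimod_equiv A C"
proof -
  let ?m = "dim_row A" and ?n = "dim_col A"
  have A: "A \<in> carrier_mat ?m ?n" by auto
  from assms(1) obtain U V where 1: "U \<in> carrier_mat ?m ?m" "unimodular U"
    "V \<in> carrier_mat ?n ?n" "unimodular V" "B = U * A * V"
    unfolding unimod_equiv_def by auto
  from assms(2) unimod_equiv_dim[OF assms(1)] obtain U' V' where
    2: "U' \<in> carrier_mat ?m ?m" "unimodular U'"
    "V' \<in> carrier_mat ?n ?n" "unimodular V'" "C = U' * B * V'"
    unfolding unimod_equiv_def by auto
  have "C = (U' * U) * A * (V * V')"
    unfolding 2(5) 1(5)
    using assoc_mult_mat[OF 2(1) 1(1) A] assoc_mult_mat[OF mult_carrier_mat[OF 2(1) mult_carrier_mat[OF 1(1) A]] 1(3) 2(3)]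
      assoc_mult_mat[OF 2(1) mult_carrier_mat[OF 1(1) A] 1(3)] by argo
  moreover have "unimod_equiv A ((U' * U) * A * (V * V'))"
    by (rule unimod_equivI[OF A]) (use 1 2 in \<open>auto intro: unimodular_mult\<close>)
  ultimately show ?thesis by simp
qed

lemma unimod_equiv_transpose:
  assumes "unimod_equiv A B"
  shows "unimod_equiv (transpose_mat A) (transpose_mat B)"
proof -
  let ?m = "dim_row A" and ?n = "dim_col A"
  have A: "A \<in> carrier_mat ?m ?n" by auto
  from assms(1) obtain U V where 1: "U \<in> carrier_mat ?m ?m" "unimodular U"
    "V \<in> carrier_mat ?n ?n" "unimodular V" "B = U * A * V"
    unfolding unimod_equiv_def by auto
  have "transpose_mat B = transpose_mat V * (transpose_mat A * transpose_mat U)"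
    unfolding 1(5) by (simp only: transpose_mult[OF mult_carrier_mat[OF 1(1) A] 1(3)]
      transpose_mult[OF 1(1) A])
  also have "\<dots> = transpose_mat V * transpose_mat A * transpose_mat U"
    by (rule assoc_mult_mat[symmetric, of _ ?n ?n _ ?m _ ?m]) (use 1 in auto)
  finally have "transpose_mat B = transpose_mat V * transpose_mat A * transpose_mat U" .
  moreover have "unimod_equiv (transpose_mat A) (transpose_mat V * transpose_mat A * transpose_mat U)"
    by (rule unimod_equivI[of _ ?n ?m]) (use 1 in \<open>auto intro: unimodular_transpose\<close>)
  ultimately show ?thesis by simp
qed

lemma unimod_equiv_left:
  assumes "A \<in> carrier_mat m n" "U \<in> carrier_mat m m" "unimodular U"
  shows "unimod_equiv A (U * A)"
  using unimod_equivI[OF assms one_carrier_mat unimodular_one]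
  unfolding right_mult_one_mat[OF mult_carrier_mat[OF assms(2,1)]] .

lemma unimod_equiv_right:
  assumes "A \<in> carrier_mat m n" "V \<in> carrier_mat n n" "unimodular V"
  shows "unimod_equiv A (A * V)"
  using unimod_equivI[OF assms(1) one_carrier_mat unimodular_one assms(2,3)]
  unfolding left_mult_one_mat[OF assms(1)] .

section \<open>Elementary row and column operations as unimodular equivalences\<close>

lemma unimod_equiv_addrow:
  assumes "k \<noteq> l" "l < dim_row A"
  shows "unimod_equiv A (addrow a k l A)"
proof -
  have A: "A \<in> carrier_mat (dim_row A) (dim_col A)" by auto
  show ?thesis unfolding addrow_mat[OF A assms(2)]
    by (rule unimod_equiv_left[OF A]) (use assms in \<open>auto simp: unimodular_def det_addrow_mat\<close>)
qed

lemma unimod_equiv_addcol: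
  assumes "k \<noteq> l" "k < dim_col A"
  shows "unimod_equiv A (addcol a l k A)"
proof -
  have A: "A \<in> carrier_mat (dim_row A) (dim_col A)" by auto
  show ?thesis unfolding addcol_mat[OF A assms(2)]
    by (rule unimod_equiv_right[OF A]) (use assms in \<open>auto simp: unimodular_def det_addrow_mat\<close>)
qed

lemma unimodular_swaprows_mat: "k < n \<Longrightarrow> l < n \<Longrightarrow> unimodular (swaprows_mat n k l)"
proof (cases "k = l")
  case True
  then have "swaprows_mat n k l = 1\<^sub>m n" by auto
  then show ?thesis by (metis unimodular_one)
qed (auto simp: unimodular_def det_swaprows_mat)

lemma unimod_equiv_swaprows:
  assumes "k < dim_row A" "l < dim_row A"
  shows "unimod_equiv A (swaprows k l A)"
proof -
  have A: "A \<in> carrier_mat (dim_row A) (dim_col A)" by auto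
  show ?thesis unfolding swaprows_mat[OF A assms]
    by (rule unimod_equiv_left[OF A]) (use assms in \<open>auto simp: unimodular_swaprows_mat\<close>)
qed

lemma unimod_equiv_swapcols:
  assumes "k < dim_col A" "l < dim_col A"
  shows "unimod_equiv A (swapcols k l A)"
proof -
  have A: "A \<in> carrier_mat (dim_row A) (dim_col A)" by auto
  show ?thesis unfolding swapcols_mat[OF A assms]
    by (rule unimod_equiv_right[OF A]) (use assms in \<open>auto simp: unimodular_swaprows_mat\<close>)
qed

lemma unimod_equiv_multrow:
  assumes "k < dim_row A" "is_unit c"
  shows "unimod_equiv A (multrow k c A)"
proof -
  have A: "A \<in> carrier_mat (dim_row A) (dim_col A)" by auto
  show ?thesis unfolding multrow_mat[OF A]
    by (rule unimod_equiv_left[OF A]) (use assms in \<open>auto simp: unimodular_def det_multrow_mat\<close>)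
qed

text \<open>Subtracting multiples of the top row from all other rows at once is left multiplication
  by a lower triangular matrix with unit diagonal, whose determinant is 1.\<close>

lemma unimod_equiv_clear_col:
  assumes "A \<in> carrier_mat (Suc m) n"
  shows "unimod_equiv A (mat (Suc m) n (\<lambda>(i,j). if i = 0 then A $$ (0,j)
           else A $$ (i,j) - q i * A $$ (0,j)))"
    (is "unimod_equiv A ?B")
proof -
  define U where "U = mat (Suc m) (Suc m) (\<lambda>(i,j). if i = j then 1 else if j = 0 then - q i else 0)"
  have U: "U \<in> carrier_mat (Suc m) (Suc m)" by (simp add: U_def)
  have "det U = prod_list (diag_mat U)"
    by (rule det_lower_triangular[OF _ U]) (auto simp: U_def)
  also have "\<dots> = 1" by (auto simp: prod_list_diag_prod U_def)
  finally have uU: "unimodular U" using U by (simp add: unimodular_iff)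
  have "U * A = ?B"
  proof (rule eq_matI, goal_cases)
    case (1 i j)
    then have ij: "i < Suc m" "j < n" by auto
    have "(U * A) $$ (i,j) = (\<Sum>k<Suc m. U $$ (i,k) * A $$ (k,j))"
      using ij assms U by (simp add: scalar_prod_def lessThan_atLeast0)
    also have "\<dots> = (\<Sum>k<Suc m. (if k = i then A $$ (k,j) else 0)
        + (if k = 0 then (if i = 0 then 0 else - q i * A $$ (k,j)) else 0))"
      by (rule sum.cong) (use ij in \<open>auto simp: U_def\<close>)
    also have "\<dots> = ?B $$ (i,j)" using ij by (auto simp: sum.distrib sum.delta)
    finally show ?case .
  qed (use assms U in auto)
  then show ?thesis using unimod_equiv_left[OF assms U uU] by simp
qed

lemma unimod_equiv_pivot:
  assumes "i < dim_row A" "j < dim_col A"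
  obtains B where "unimod_equiv A B" "B $$ (0,0) = A $$ (i,j)"
proof
  show "unimod_equiv A (swapcols 0 j (swaprows 0 i A))"
    by (rule unimod_equiv_trans[OF unimod_equiv_swaprows unimod_equiv_swapcols])
      (use assms in auto)
  show "swapcols 0 j (swaprows 0 i A) $$ (0,0) = A $$ (i,j)"
    using assms by (subst index_mat_swapcols) auto
qed

text \<open>A nonzero entry of least degree among all matrices equivalent to \<open>A\<close> divides everything:
  a division with remainder would otherwise produce a smaller one.\<close>
lemma unimod_equiv_reduce:
  fixes A :: "'a::field poly mat"
  assumes A: "A \<in> carrier_mat m n" and nz: "A \<noteq> 0\<^sub>m m n"
  obtains B where "unimod_equiv A B" "0 < m" "0 < n" "lead_coeff (B $$ (0,0)) = 1"
    "\<And>i. 0 < i \<Longrightarrow> i < m \<Longrightarrow> B $$ (i,0) = 0" "\<And>j. 0 < j \<Longrightarrow> j < n \<Longrightarrow> B $$ (0,j) = 0"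
    "\<And>i j. i < m \<Longrightarrow> j < n \<Longrightarrow> B $$ (0,0) dvd B $$ (i,j)"
proof -
  define Q where "Q k \<longleftrightarrow> (\<exists>B i j. unimod_equiv A B \<and> i < m \<and> j < n \<and> B $$ (i,j) \<noteq> 0 \<and>
     degree (B $$ (i,j)) = k)" for k
  from A nz obtain i0 j0 where ij0: "i0 < m" "j0 < n" "A $$ (i0,j0) \<noteq> 0"
    by (metis carrier_matD eq_matI index_zero_mat)
  then have "Q (degree (A $$ (i0,j0)))" unfolding Q_def using unimod_equiv_refl by blast
  then have Qk: "Q (LEAST k. Q k)" by (rule LeastI)
  define k where "k = (LEAST k. Q k)"
  have min: "k \<le> degree (B $$ (i,j))"
    if "unimod_equiv A B" "i < m" "j < n" "B $$ (i,j) \<noteq> 0" for B i j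
    unfolding k_def by (rule Least_le) (use that Q_def in blast)
  note dim = unimod_equiv_dim
  have dvd_row: "B $$ (0,0) dvd B $$ (0,j)"
    if B: "unimod_equiv A B" and nzB: "B $$ (0,0) \<noteq> 0" and dg: "degree (B $$ (0,0)) = k"
      and j: "0 < j" "j < n" for B j
  proof (rule ccontr)
    assume nd: "\<not> B $$ (0,0) dvd B $$ (0,j)"
    let ?e = "B $$ (0,0)" and ?b = "B $$ (0,j)"
    let ?C = "addcol (- (?b div ?e)) j 0 B"
    have d: "dim_row B = m" "dim_col B = n" using dim[OF B] A by auto
    have C: "unimod_equiv A ?C"
      by (rule unimod_equiv_trans[OF B unimod_equiv_addcol]) (use d j in auto)
    have "?C $$ (0,j) = ?b - (?b div ?e) * ?e"
      using d ij0 j by (subst index_mat_addcol) auto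
    then have Ce: "?C $$ (0,j) = ?b mod ?e" by (simp add: minus_div_mult_eq_mod)
    have nz: "?b mod ?e \<noteq> 0" using nd by (simp add: dvd_eq_mod_eq_0)
    then have "degree (?b mod ?e) < k" using degree_mod_less[OF nzB, of ?b] dg by auto
    with min[OF C, of 0 j] Ce nz j ij0 show False by auto
  qed
  have dvd_col: "B $$ (0,0) dvd B $$ (i,0)"
    if B: "unimod_equiv A B" and nzB: "B $$ (0,0) \<noteq> 0" and dg: "degree (B $$ (0,0)) = k"
      and j: "0 < i" "i < m" for B i
  proof (rule ccontr)
    assume nd: "\<not> B $$ (0,0) dvd B $$ (i,0)"
    let ?e = "B $$ (0,0)" and ?b = "B $$ (i,0)"
    let ?C = "addrow (- (?b div ?e)) i 0 B"
    have d: "dim_row B = m" "dim_col B = n" using dim[OF B] A by auto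
    have C: "unimod_equiv A ?C"
      by (rule unimod_equiv_trans[OF B unimod_equiv_addrow]) (use d j in auto)
    have "?C $$ (i,0) = ?b - (?b div ?e) * ?e"
      using d ij0 j by (subst index_mat_addrow) auto
    then have Ce: "?C $$ (i,0) = ?b mod ?e" by (simp add: minus_div_mult_eq_mod)
    have nz: "?b mod ?e \<noteq> 0" using nd by (simp add: dvd_eq_mod_eq_0)
    then have "degree (?b mod ?e) < k" using degree_mod_less[OF nzB, of ?b] dg by auto
    with min[OF C, of i 0] Ce nz j ij0 show False by auto
  qed
  from Qk[folded k_def] obtain B0 i1 j1 where B0: "unimod_equiv A B0" "i1 < m" "j1 < n"
    "B0 $$ (i1,j1) \<noteq> 0" "degree (B0 $$ (i1,j1)) = k" unfolding Q_def by blast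
  have d0: "dim_row B0 = m" "dim_col B0 = n" using dim[OF B0(1)] A by auto
  from unimod_equiv_pivot[of i1 B0 j1] B0 d0 obtain B1 where
    B1: "unimod_equiv B0 B1" "B1 $$ (0,0) = B0 $$ (i1,j1)" by auto
  define e where "e = B0 $$ (i1,j1)"
  have AB1: "unimod_equiv A B1" by (rule unimod_equiv_trans[OF B0(1) B1(1)])
  have d1: "dim_row B1 = m" "dim_col B1 = n" using dim[OF AB1] A by auto
  define m' where "m' = m - 1"
  define n' where "n' = n - 1"
  have m: "m = Suc m'" and n: "n = Suc n'" using ij0 by (auto simp: m'_def n'_def)
  \<comment> \<open>The corner of \<open>B1\<close> is \<open>e\<close>, of the minimal degree
    \<open>k\<close>, so \<open>dvd_col\<close> makes the quotients exact and the first column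
    becomes zero below the corner.\<close>
  define B2 where "B2 = mat m n (\<lambda>(i,j). if i = 0 then B1 $$ (0,j)
           else B1 $$ (i,j) - (B1 $$ (i,0) div e) * B1 $$ (0,j))"
  have AB2: "unimod_equiv A B2"
    unfolding B2_def m
    by (rule unimod_equiv_trans[OF AB1 unimod_equiv_clear_col]) (use d1 m in auto)
  have col2: "B2 $$ (i,0) = 0" if "0 < i" "i < m" for i
    using dvd_col[OF AB1 _ _ that] B1(2) B0 that n
    by (auto simp: B2_def e_def)
  have B200: "B2 $$ (0,0) = e" using m n B1 by (auto simp: B2_def e_def)
  have d2: "dim_row B2 = m" "dim_col B2 = n" by (auto simp: B2_def)
  \<comment> \<open>The first row is cleared by the same operation on the transpose. The first
    column is left as it was.\<close>
  define T where "T = mat n m (\<lambda>(i,j). if i = 0 then (transpose_mat B2) $$ (0,j)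
           else (transpose_mat B2) $$ (i,j) - (B2 $$ (0,i) div e) * (transpose_mat B2) $$ (0,j))"
  define B3 where "B3 = transpose_mat T"
  have "unimod_equiv (transpose_mat B2) T"
    unfolding T_def n
    by (rule unimod_equiv_clear_col) (use d2 n in auto)
  from unimod_equiv_transpose[OF this] have "unimod_equiv B2 B3" by (simp add: B3_def)
  then have AB3: "unimod_equiv A B3" by (rule unimod_equiv_trans[OF AB2])
  have B3: "B3 $$ (i,j) = (if j = 0 then B2 $$ (i,0) else
      B2 $$ (i,j) - (B2 $$ (0,j) div e) * B2 $$ (i,0))" if "i < m" "j < n" for i j
    using that d2 m n by (auto simp: B3_def T_def)
  have B300: "B3 $$ (0,0) = e" using B3 m n B200 by auto
  have col3: "B3 $$ (i,0) = 0" if "0 < i" "i < m" for i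
    using B3[of i 0] col2 that n by auto
  have row3: "B3 $$ (0,j) = 0" if "0 < j" "j < n" for j
    using B3[of 0 j] dvd_row[OF AB2 _ _ that] B0 that m B200 by (auto simp: e_def)
  have d3: "dim_row B3 = m" "dim_col B3 = n" using dim[OF AB3] A by auto
  have dvd3: "e dvd B3 $$ (i,j)" if ij: "i < m" "j < n" for i j
  proof (cases "i = 0 \<or> j = 0")
    case True
    then show ?thesis using row3[of j] col3[of i] B300 ij by (cases "i = 0"; cases "j = 0") auto
  next
    case False
    \<comment> \<open>Adding row \<open>i\<close> to row 0 keeps the corner \<open>e\<close>,
      because \<open>B3 $$ (i,0) = 0\<close>, and brings entry \<open>(i,j)\<close> into row 0,
      because \<open>B3 $$ (0,j) = 0\<close>. There \<open>dvd_row\<close> applies.\<close>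
    let ?C = "addrow 1 0 i B3"
    have C: "unimod_equiv A ?C"
      by (rule unimod_equiv_trans[OF AB3 unimod_equiv_addrow]) (use d3 ij False in auto)
    have "?C $$ (0,0) = e" "?C $$ (0,j) = B3 $$ (i,j)"
      using d3 m n ij False B300 col3[of i] row3[of j] by auto
    with dvd_row[OF C, of j] B0 ij False show ?thesis by (auto simp: e_def)
  qed
  \<comment> \<open>A constant factor on the top row makes the corner monic.\<close>
  define c where "c = [:inverse (lead_coeff e):]"
  have e0: "e \<noteq> 0" using B0 e_def by simp
  then have uc: "is_unit c" by (simp add: c_def is_unit_triv)
  define B where "B = multrow 0 c B3"
  have AB: "unimod_equiv A B" unfolding B_def
    by (rule unimod_equiv_trans[OF AB3 unimod_equiv_multrow]) (use d3 m uc in auto)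
  have Bx: "B $$ (i,j) = (if i = 0 then c * B3 $$ (i,j) else B3 $$ (i,j))"
    if "i < m" "j < n" for i j
    using that d3 by (auto simp: B_def)
  have B00: "B $$ (0,0) = c * e" using Bx[of 0 0] m n B300 by simp
  show thesis
  proof (rule that[OF AB])
    show "0 < m" "0 < n" using m n by auto
    show "lead_coeff (B $$ (0,0)) = 1"
      unfolding B00 using e0 by (simp add: c_def lead_coeff_mult)
    show "B $$ (i,0) = 0" if "0 < i" "i < m" for i using that Bx[of i 0] col3[of i] n by auto
    show "B $$ (0,j) = 0" if "0 < j" "j < n" for j using that Bx[of 0 j] row3[of j] m by auto
    show "B $$ (0,0) dvd B $$ (i,j)" if "i < m" "j < n" for i j
      unfolding B00 using that Bx[of i j] dvd3[of i j] uc
      by (auto simp: mult_unit_dvd_iff' dvd_mult)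
  qed
qed

text \<open>A common divisor of all entries survives multiplication on either side, hence any
  equivalence. This carries divisibility by the pivot over to the Smith form of the remaining
  block.\<close>

lemma dvd_mult_mat:
  fixes e :: "'a::comm_semiring_1"
  assumes "A \<in> carrier_mat m k" "B \<in> carrier_mat k n"
    "(\<forall>i<m. \<forall>j<k. e dvd A $$ (i,j)) \<or> (\<forall>i<k. \<forall>j<n. e dvd B $$ (i,j))"
    "i < m" "j < n"
  shows "e dvd (A * B) $$ (i,j)"
proof -
  have "(A * B) $$ (i,j) = (\<Sum>l<k. A $$ (i,l) * B $$ (l,j))"
    using assms(1,2,4,5) by (simp add: scalar_prod_def lessThan_atLeast0)
  also have "e dvd \<dots>"
    by (rule dvd_sum) (use assms(3-5) in \<open>auto intro: dvd_mult dvd_mult2\<close>)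
  finally show ?thesis .
qed

lemma unimodular_four_block:
  assumes "U \<in> carrier_mat n n" "unimodular U"
  shows "unimodular (four_block_mat (1\<^sub>m 1) (0\<^sub>m 1 n) (0\<^sub>m n 1) U)" (is "unimodular ?F")
proof -
  have "det ?F = det (1\<^sub>m 1) * det U"
    by (rule det_four_block_mat_lower_left_zero) (use assms in auto)
  then show ?thesis
    using assms by (auto simp: unimodular_def)
qed

text \<open>Bordering the two transformation matrices by a 1 in the corner leaves the pivot
  \<open>e\<close> untouched while they act on the remaining block.\<close>

lemma unimod_equiv_four_block:
  assumes "unimod_equiv A S" "A \<in> carrier_mat m n"
  shows "unimod_equiv (four_block_mat (mat 1 1 (\<lambda>_. e)) (0\<^sub>m 1 n) (0\<^sub>m m 1) A)
     (four_block_mat (mat 1 1 (\<lambda>_. e)) (0\<^sub>m 1 n) (0\<^sub>m m 1) S)"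
proof -
  from assms obtain U V where 1: "U \<in> carrier_mat m m" "unimodular U"
    "V \<in> carrier_mat n n" "unimodular V" "S = U * A * V"
    unfolding unimod_equiv_def by auto
  let ?M = "mat 1 1 (\<lambda>_. e)"
  let ?B = "four_block_mat ?M (0\<^sub>m 1 n) (0\<^sub>m m 1) A"
  let ?U = "four_block_mat (1\<^sub>m 1) (0\<^sub>m 1 m) (0\<^sub>m m 1) U"
  let ?V = "four_block_mat (1\<^sub>m 1) (0\<^sub>m 1 n) (0\<^sub>m n 1) V"
  have M: "?M \<in> carrier_mat 1 1" by simp
  have UA: "U * A \<in> carrier_mat m n" using 1 assms by auto
  have "?U * ?B = four_block_mat ?M (0\<^sub>m 1 n) (0\<^sub>m m 1) (U * A)"
    by (subst mult_four_block_mat[of _ 1 1 _ m _ m _ _ 1 _ n]) (use 1 assms M UA in \<open>auto simp: left_mult_zero_mat right_mult_zero_mat\<close>)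
  moreover have "four_block_mat ?M (0\<^sub>m 1 n) (0\<^sub>m m 1) (U * A) * ?V =
     four_block_mat ?M (0\<^sub>m 1 n) (0\<^sub>m m 1) (U * A * V)"
    by (subst mult_four_block_mat[of _ 1 1 _ n _ m _ _ 1 _ n]) (use 1 assms M UA in auto)
  ultimately have "?U * ?B * ?V = four_block_mat ?M (0\<^sub>m 1 n) (0\<^sub>m m 1) S" using 1 by simp
  moreover have "unimod_equiv ?B (?U * ?B * ?V)"
    by (rule unimod_equivI[of _ "1 + m" "1 + n"])
      (use 1 assms M unimodular_four_block in \<open>auto intro!: four_block_carrier_mat simp del: One_nat_def\<close>)
  ultimately show ?thesis by simp
qed

text \<open>Induction on the number of rows: \<open>unimod_equiv_reduce\<close> splits off a monic
  pivot, and the induction hypothesis treats the complementary block.\<close>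

lemma smith_form_exists:
  fixes A :: "'a::field poly mat"
  assumes "A \<in> carrier_mat m n"
  shows "\<exists>S es. unimod_equiv A S \<and> smith_diag S es"
  using assms
proof (induction m arbitrary: A n)
  case 0
  then show ?case
    by (intro exI[of _ A] exI[of _ "[]"]) (auto simp: unimod_equiv_refl smith_diag_def)
next
  case (Suc m A n)
  show ?case
  proof (cases "A = 0\<^sub>m (Suc m) n")
    case True
    then show ?thesis
      by (intro exI[of _ A] exI[of _ "[]"]) (auto simp: unimod_equiv_refl smith_diag_def)
  next
    case False
    from unimod_equiv_reduce[OF Suc.prems False] obtain B where B: "unimod_equiv A B" "0 < n"
      "lead_coeff (B $$ (0,0)) = 1"
      "\<And>i. 0 < i \<Longrightarrow> i < Suc m \<Longrightarrow> B $$ (i,0) = 0" "\<And>j. 0 < j \<Longrightarrow> j < n \<Longrightarrow> B $$ (0,j) = 0"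
      "\<And>i j. i < Suc m \<Longrightarrow> j < n \<Longrightarrow> B $$ (0,0) dvd B $$ (i,j)" by metis
    then obtain n' where n: "n = Suc n'" by (cases n) auto
    define e where "e = B $$ (0,0)"
    define C where "C = mat m n' (\<lambda>(i,j). B $$ (Suc i, Suc j))"
    have C: "C \<in> carrier_mat m n'" by (simp add: C_def)
    have dB: "dim_row B = Suc m" "dim_col B = n" using unimod_equiv_dim[OF B(1)] Suc.prems by auto
    have BC: "B = four_block_mat (mat 1 1 (\<lambda>_. e)) (0\<^sub>m 1 n') (0\<^sub>m m 1) C"
      by (rule eq_matI) (use dB n B in \<open>auto simp: C_def e_def\<close>)
    from Suc.IH[OF C] obtain S es where S: "unimod_equiv C S" "smith_diag S es" by blast
    let ?S = "four_block_mat (mat 1 1 (\<lambda>_. e)) (0\<^sub>m 1 n') (0\<^sub>m m 1) S"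
    have AS: "unimod_equiv A ?S"
      using unimod_equiv_trans[OF B(1)[unfolded BC] unimod_equiv_four_block[OF S(1) C]] .
    from S(1) C obtain U V where UV: "U \<in> carrier_mat m m" 
      "V \<in> carrier_mat n' n'" "S = U * C * V"
      unfolding unimod_equiv_def by auto
    have dS: "dim_row S = m" "dim_col S = n'" using UV C by auto
    \<comment> \<open>The pivot divides the block \<open>C\<close> and therefore \<open>S\<close>,
      which yields the one new link of the divisibility chain, from \<open>e\<close> to the head of
      \<open>es\<close>.\<close>
    have eC: "\<forall>i<m. \<forall>j<n'. e dvd C $$ (i,j)" using B(6) n by (auto simp: C_def e_def)
    have eUC: "\<forall>i<m. \<forall>j<n'. e dvd (U * C) $$ (i,j)"
      by (intro allI impI dvd_mult_mat[OF UV(1) C]) (use eC in auto)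
    have eS: "e dvd S $$ (i,j)" if "i < m" "j < n'" for i j
      unfolding UV(3) by (rule dvd_mult_mat[OF _ UV(2) _ that]) (use UV C eUC in auto)
    have e1: "lead_coeff e = 1" using B(3) e_def by simp
    then have e0: "e \<noteq> 0" by auto
    have "smith_diag ?S (e # es)"
      unfolding smith_diag_def
    proof (intro conjI allI impI, goal_cases)
      case 1 
      then show ?case using S(2) dS by (auto simp: smith_diag_def)
    next
      case (2 i j)
      then show ?case using S(2) dS by (cases i; cases j) (auto simp: smith_diag_def)
    next
      case (3 i)
      then show ?case using S(2) dS by (cases i) (auto simp: smith_diag_def)
    next
      case (4 i)
      then show ?case using S(2) dS e0 by (cases i) (auto simp: smith_diag_def)
    next
      case (5 i)
      then show ?case using S(2) dS e1 by (cases i) (auto simp: smith_diag_def)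
    next
      case (6 i)
      then show ?case using S(2) dS by (cases i) (auto simp: smith_diag_def)
    next
      case (7 i)
      show ?case
      proof (cases i)
        case 0
        then have l: "0 < length es" using 7 by simp
        have "length es \<le> m" "length es \<le> n'" using S(2) dS by (auto simp: smith_diag_def)
        with l have mn: "0 < m" "0 < n'" by linarith+
        have "S $$ (0,0) = es ! 0" using l S(2) unfolding smith_diag_def by blast
        then show ?thesis using eS[OF mn] 0 by simp
      next
        case (Suc i')
        then show ?thesis using 7 S(2) by (auto simp: smith_diag_def)
      qed
    qed
    with AS show ?thesis by blast
  qed
qed

text \<open>The absence of eigenvalues is a statement about every list \<open>es\<close> of
  invariant polynomials; it gains content only once such a list exists.\<close>

lemma invariant_polys_exist: "\<exists>es. invariant_polys A es"
  using smith_form_exists[of A "dim_row A" "dim_col A"] by (auto simp: invariant_polys_iff)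

section \<open>Column spaces and rank\<close>

text \<open>Padding with zero rows gives a square matrix \<open>B\<close>. Row \<open>s\<close> of
  \<open>B\<close> is zero, so the transpose kills a unit vector and
  \<open>det B = 0\<close>.\<close>

lemma wide_mat_kernel:
  fixes A :: "'a::field mat"
  assumes A: "A \<in> carrier_mat s r" and sr: "s < r"
  obtains v where "v \<in> carrier_vec r" "v \<noteq> 0\<^sub>v r" "A *\<^sub>v v = 0\<^sub>v s"
proof -
  define B where "B = mat r r (\<lambda>(i,j). if i < s then A $$ (i,j) else 0)"
  have B: "B \<in> carrier_mat r r" by (simp add: B_def)
  have "transpose_mat B *\<^sub>v unit_vec r s = 0\<^sub>v r"
    by (rule eq_vecI) (use sr in \<open>auto simp: B_def\<close>)
  moreover have "unit_vec r s \<noteq> (0\<^sub>v r :: 'a vec)" using sr by simp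
  ultimately have "det (transpose_mat B) = 0"
    using B by (subst det_0_iff_vec_prod_zero_field[of _ r]) (auto intro!: exI[of _ "unit_vec r s"])
  then have "det B = 0" using det_transpose[OF B] by simp
  then obtain v where v: "v \<in> carrier_vec r" "v \<noteq> 0\<^sub>v r" "B *\<^sub>v v = 0\<^sub>v r"
    using det_0_iff_vec_prod_zero_field[OF B] by blast
  have "A *\<^sub>v v = 0\<^sub>v s"
  proof (rule eq_vecI)
    fix i assume "i < dim_vec (0\<^sub>v s :: 'a vec)"
    then have i: "i < s" by simp
    have "row A i = row B i" by (rule eq_vecI) (use A i sr in \<open>auto simp: B_def\<close>)
    moreover have "(B *\<^sub>v v) $ i = 0" using v(3) i sr by simp
    ultimately show "(A *\<^sub>v v) $ i = 0\<^sub>v s $ i" using A B i sr by simp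
  qed (use A in simp)
  with v that show thesis by blast
qed

section \<open>Embedding of polynomial matrices into matrices over the rational functions\<close>

lemma to_frac_eq: "to_frac A = map_mat to_fract A"
  by (rule eq_matI) (auto simp: to_frac_def to_fract_def)

lemma to_frac_carrier [simp]: "to_frac A \<in> carrier_mat m n \<longleftrightarrow> A \<in> carrier_mat m n"
  and to_frac_dim [simp]: "dim_row (to_frac A) = dim_row A" "dim_col (to_frac A) = dim_col A"
  by (auto simp: to_frac_def)

lemma inj_comm_ring_hom_to_fract: "inj_comm_ring_hom to_fract"
  by unfold_locales auto

lemma to_frac_mult:
  assumes "A \<in> carrier_mat m k" "B \<in> carrier_mat k n"
  shows "to_frac (A * B) = to_frac A * to_frac B"
proof -
  interpret inj_comm_ring_hom to_fract by (rule inj_comm_ring_hom_to_fract)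
  show ?thesis unfolding to_frac_eq by (rule mat_hom_mult[OF assms])
qed

lemma to_frac_one: "to_frac (1\<^sub>m n) = 1\<^sub>m n"
proof -
  interpret inj_comm_ring_hom to_fract by (rule inj_comm_ring_hom_to_fract)
  show ?thesis unfolding to_frac_eq by (rule mat_hom_one)
qed

lemma to_frac_inj: "to_frac A = to_frac B \<Longrightarrow> A = B"
proof -
  interpret inj_comm_ring_hom to_fract by (rule inj_comm_ring_hom_to_fract)
  show "to_frac A = to_frac B \<Longrightarrow> A = B" unfolding to_frac_eq by (rule mat_hom_inj)
qed

lemma det_to_frac: "det (to_frac A) = to_fract (det A)"
proof -
  interpret inj_comm_ring_hom to_fract by (rule inj_comm_ring_hom_to_fract)
  show ?thesis unfolding to_frac_eq by (rule hom_det)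
qed

text \<open>Holds over the field of fractions and descends because the embedding is
  injective.\<close>

lemma poly_mat_left_right_inverse:
  fixes A B :: "'a::field poly mat"
  assumes "A \<in> carrier_mat n n" "B \<in> carrier_mat n n" "A * B = 1\<^sub>m n"
  shows "B * A = 1\<^sub>m n"
proof (rule to_frac_inj)
  have "to_frac A * to_frac B = 1\<^sub>m n"
    using assms by (simp flip: to_frac_mult add: to_frac_one)
  then have "to_frac B * to_frac A = 1\<^sub>m n"
    using mat_mult_left_right_inverse[of "to_frac A" n "to_frac B"] assms by simp
  then show "to_frac (B * A) = to_frac (1\<^sub>m n)"
    using assms by (simp add: to_frac_mult[of B n n A n] to_frac_one)
qed

text \<open>The independence half of \<open>poly_col_basis\<close>, taken over the rational
  functions.\<close>

definition full_col_rank :: "'a::field poly mat \<Rightarrow> bool" where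
  "full_col_rank A \<longleftrightarrow>
     (\<forall>v \<in> carrier_vec (dim_col A). to_frac A *\<^sub>v v = 0\<^sub>v (dim_row A) \<longrightarrow> v = 0\<^sub>v (dim_col A))"

lemma poly_col_basis_iff: "poly_col_basis S B \<longleftrightarrow> full_col_rank B \<and> col_space B = S"
  by (simp add: poly_col_basis_def full_col_rank_def)

lemma full_col_rankD:
  assumes "full_col_rank A" "A \<in> carrier_mat m n" "v \<in> carrier_vec n" "to_frac A *\<^sub>v v = 0\<^sub>v m"
  shows "v = 0\<^sub>v n"
  using assms unfolding full_col_rank_def by auto

lemma full_col_rankI_left_inverse:
  assumes A: "A \<in> carrier_mat m n" and X: "X \<in> carrier_mat n m" and XA: "X * A = 1\<^sub>m n"
  shows "full_col_rank A"
proof -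
  have "v = 0\<^sub>v n" if v: "v \<in> carrier_vec n" "to_frac A *\<^sub>v v = 0\<^sub>v m" for v
  proof -
    have "v = to_frac (X * A) *\<^sub>v v" using v XA by (simp add: to_frac_one)
    also have "\<dots> = to_frac X *\<^sub>v (to_frac A *\<^sub>v v)"
      unfolding to_frac_mult[OF X A]
      by (rule assoc_mult_mat_vec[of _ n m _ n]) (use A X v in simp_all)
    also have "\<dots> = 0\<^sub>v n" using v(2) X by auto
    finally show ?thesis .
  qed
  then show ?thesis using A unfolding full_col_rank_def by auto
qed

lemma col_space_subset_carrier: "A \<in> carrier_mat m n \<Longrightarrow> col_space A \<subseteq> carrier_vec m"
  unfolding col_space_def by auto

lemma col_space_mult_subset:
  assumes A: "A \<in> carrier_mat m k" and B: "B \<in> carrier_mat k n"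
  shows "col_space (A * B) \<subseteq> col_space A"
proof
  fix x assume "x \<in> col_space (A * B)"
  then obtain v where v: "v \<in> carrier_vec n" "x = to_frac (A * B) *\<^sub>v v"
    using B by (auto simp: col_space_def)
  then have "x = to_frac A *\<^sub>v (to_frac B *\<^sub>v v)"
    unfolding v(2) to_frac_mult[OF A B]
    by (intro assoc_mult_mat_vec[of _ m k _ n]) (use A B v in simp_all)
  then show "x \<in> col_space A"
    using A B v unfolding col_space_def by auto
qed

text \<open>The columns of \<open>Y\<close> are chosen preimages of the columns of \<open>L\<close>,
  so its entries are in general only rational functions.\<close>

lemma col_space_subset_factor:
  assumes L: "L \<in> carrier_mat m r" and P: "P \<in> carrier_mat m n"
    and sub: "col_space L \<subseteq> col_space P"
  obtains Y where "Y \<in> carrier_mat n r" "to_frac P * Y = to_frac L"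
proof -
  have "\<exists>v. v \<in> carrier_vec n \<and> col (to_frac L) j = to_frac P *\<^sub>v v" if j: "j < r" for j
  proof -
    have "to_frac L *\<^sub>v unit_vec r j \<in> col_space L" using L unfolding col_space_def by auto
    then have "to_frac L *\<^sub>v unit_vec r j \<in> col_space P" using sub by blast
    moreover have "to_frac L *\<^sub>v unit_vec r j = col (to_frac L) j"
      by (rule eq_vecI) (use L j in auto)
    ultimately show ?thesis using P unfolding col_space_def by auto
  qed
  then obtain f where f: "\<And>j. j < r \<Longrightarrow> f j \<in> carrier_vec n \<and> col (to_frac L) j = to_frac P *\<^sub>v f j"
    by metis
  define Y where "Y = mat n r (\<lambda>(i,j). f j $ i)"
  have Y: "Y \<in> carrier_mat n r" by (simp add: Y_def)
  have cY: "col Y j = f j" if "j < r" for j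
    by (rule eq_vecI) (use f[OF that] that in \<open>auto simp: Y_def\<close>)
  have "to_frac P * Y = to_frac L"
  proof (rule eq_matI)
    fix i j assume "i < dim_row (to_frac L)" "j < dim_col (to_frac L)"
    then have ij: "i < m" "j < r" using L by auto
    have "(to_frac P * Y) $$ (i,j) = (to_frac P *\<^sub>v f j) $ i"
      using ij P Y cY by simp
    also have "\<dots> = col (to_frac L) j $ i" using f[OF ij(2)] by simp
    finally show "(to_frac P * Y) $$ (i,j) = to_frac L $$ (i,j)" using ij L by simp
  qed (use P L Y in auto)
  with Y that show thesis by blast
qed

text \<open>Rank argument: write \<open>L\<close> as \<open>P * Y\<close> over the fractions. If
  \<open>s < r\<close>, then \<open>B * Y\<close> kills some nonzero \<open>v\<close>, so
  \<open>c\<close> times \<open>P * Y\<close> kills \<open>v\<close>, and cancelling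
  \<open>c\<close> contradicts the independence of the columns of \<open>L\<close>. The factor
  \<open>c\<close> allows for a power of the variable that arises on undoing a reversal.\<close>

lemma full_col_rank_le_inner_dim:
  assumes L: "L \<in> carrier_mat m r" and rk: "full_col_rank L"
    and P: "P \<in> carrier_mat m n" and sub: "col_space L \<subseteq> col_space P"
    and A: "A \<in> carrier_mat m s" and B: "B \<in> carrier_mat s n"
    and c: "c \<noteq> 0" and eq: "c \<cdot>\<^sub>m P = A * B"
  shows "r \<le> s"
proof (rule ccontr)
  assume "\<not> r \<le> s"
  then have sr: "s < r" by simp
  obtain Y where Y: "Y \<in> carrier_mat n r" "to_frac P * Y = to_frac L"
    by (rule col_space_subset_factor[OF L P sub])
  let ?A = "to_frac A" and ?B = "to_frac B" and ?P = "to_frac P"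
  have c': "?A \<in> carrier_mat m s" "?B \<in> carrier_mat s n" "?P \<in> carrier_mat m n"
    using A B P by auto
  obtain v where v: "v \<in> carrier_vec r" "v \<noteq> 0\<^sub>v r" "(?B * Y) *\<^sub>v v = 0\<^sub>v s"
    by (rule wide_mat_kernel[OF mult_carrier_mat[OF c'(2) Y(1)] sr])
  have Yv: "Y *\<^sub>v v \<in> carrier_vec n" using Y v by auto
  have "(to_fract c \<cdot>\<^sub>m ?P) *\<^sub>v (Y *\<^sub>v v) = to_frac (A * B) *\<^sub>v (Y *\<^sub>v v)"
    unfolding eq[symmetric] by (rule arg_cong2[where f = mult_mat_vec], rule eq_matI) (auto simp: to_frac_eq)
  also have "\<dots> = ?A *\<^sub>v (?B *\<^sub>v (Y *\<^sub>v v))"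
    unfolding to_frac_mult[OF A B] by (rule assoc_mult_mat_vec[OF c'(1,2) Yv])
  also have "?B *\<^sub>v (Y *\<^sub>v v) = 0\<^sub>v s"
    using assoc_mult_mat_vec[OF c'(2) Y(1) v(1)] v(3) by simp
  also have "?A *\<^sub>v 0\<^sub>v s = 0\<^sub>v m" using c' by auto
  finally have 0: "(to_fract c \<cdot>\<^sub>m ?P) *\<^sub>v (Y *\<^sub>v v) = 0\<^sub>v m" .
  have "?P *\<^sub>v (Y *\<^sub>v v) = 0\<^sub>v m"
  proof (rule eq_vecI)
    fix i assume "i < dim_vec (0\<^sub>v m :: 'a poly fract vec)"
    then have i: "i < m" by simp
    have "to_fract c * (?P *\<^sub>v w) $ i = ((to_fract c \<cdot>\<^sub>m ?P) *\<^sub>v w) $ i"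
      if "w \<in> carrier_vec n" for w
      using i P that by (simp add: smult_scalar_prod_distrib[of _ n])
    from this[OF Yv]
    have "to_fract c * (?P *\<^sub>v (Y *\<^sub>v v)) $ i = ((to_fract c \<cdot>\<^sub>m ?P) *\<^sub>v (Y *\<^sub>v v)) $ i" .
    then show "(?P *\<^sub>v (Y *\<^sub>v v)) $ i = 0\<^sub>v m $ i" using 0 c i by simp
  qed (use P in simp)
  then have "to_frac L *\<^sub>v v = 0\<^sub>v m"
    using assoc_mult_mat_vec[OF c'(3) Y(1) v(1)] Y(2) by simp
  with full_col_rankD[OF rk L v(1)] v(2) show False by blast
qed

section \<open>Matrices without finite or infinite eigenvalues\<close>

text \<open>A diagonal matrix with \<open>length es\<close> nonzero entries factors through that
  inner dimension. Together with \<open>full_col_rank_le_inner_dim\<close> this bounds the number of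
  invariant polynomials from below.\<close>

lemma invariant_polys_factor:
  assumes Q: "Q \<in> carrier_mat m n" and es: "invariant_polys Q es"
  obtains A B where "A \<in> carrier_mat m (length es)" "B \<in> carrier_mat (length es) n" "Q = A * B"
proof -
  let ?s = "length es"
  from es Q obtain U V where U: "U \<in> carrier_mat m m" "unimodular U"
    and V: "V \<in> carrier_mat n n" "unimodular V" and S: "smith_diag (U * Q * V) es"
    unfolding invariant_polys_def by auto
  obtain U' where U': "U' \<in> carrier_mat m m" "U * U' = 1\<^sub>m m" "U' * U = 1\<^sub>m m"
    by (rule unimodular_inverse[OF U])
  obtain V' where V': "V' \<in> carrier_mat n n" "V * V' = 1\<^sub>m n" "V' * V = 1\<^sub>m n"
    by (rule unimodular_inverse[OF V])
  define S where "S = U * Q * V"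
  have UQ: "U * Q \<in> carrier_mat m n" using U Q by simp
  have Sc: "S \<in> carrier_mat m n" unfolding S_def by (rule mult_carrier_mat[OF UQ V(1)])
  have "S * V' = (U * Q) * (V * V')" unfolding S_def by (rule assoc_mult_mat[OF UQ V(1) V'(1)])
  also have "\<dots> = U * Q" unfolding V'(2) by (rule right_mult_one_mat[OF UQ])
  finally have "U' * (S * V') = U' * (U * Q)" by simp
  also have "\<dots> = (U' * U) * Q" by (rule assoc_mult_mat[symmetric, OF U'(1) U(1) Q])
  also have "\<dots> = Q" unfolding U'(3) by (rule left_mult_one_mat[OF Q])
  finally have QS: "Q = U' * (S * V')" by simp
  define D1 where "D1 = mat m ?s (\<lambda>(i,j). if i = j then es ! j else 0)"
  define D2 where "D2 = mat ?s n (\<lambda>(i,j). if i = j then (1::'a poly) else 0)"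
  have D: "D1 \<in> carrier_mat m ?s" "D2 \<in> carrier_mat ?s n" by (auto simp: D1_def D2_def)
  have sd: "smith_diag S es" using S S_def by simp
  have SD: "S = D1 * D2"
  proof (rule eq_matI)
    fix i j assume "i < dim_row (D1 * D2)" "j < dim_col (D1 * D2)"
    then have ij: "i < m" "j < n" using D by auto
    have "(D1 * D2) $$ (i,j) = (\<Sum>k<?s. D1 $$ (i,k) * D2 $$ (k,j))"
      using ij D by (simp add: scalar_prod_def lessThan_atLeast0)
    also have "\<dots> = (\<Sum>k<?s. if k = j then (if i = k then es ! k else 0) else 0)"
      by (rule sum.cong) (use ij in \<open>auto simp: D1_def D2_def\<close>)
    also have "\<dots> = (if j < ?s \<and> i = j then es ! j else 0)" by simp
    also have "\<dots> = S $$ (i,j)"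
      using sd ij Sc unfolding smith_diag_def by (cases "i = j"; cases "j < ?s") auto
    finally show "S $$ (i,j) = (D1 * D2) $$ (i,j)" by simp
  qed (use Sc D in auto)
  have D2V: "D2 * V' \<in> carrier_mat ?s n" using D V' by simp
  have "Q = U' * (D1 * (D2 * V'))"
    unfolding QS SD assoc_mult_mat[OF D V'(1)] ..
  also have "\<dots> = (U' * D1) * (D2 * V')"
    by (rule assoc_mult_mat[symmetric, OF U'(1) D(1) D2V])
  finally have "Q = (U' * D1) * (D2 * V')" .
  then show thesis by (rule that[OF mult_carrier_mat[OF U'(1) D(1)] D2V])
qed

text \<open>The first \<open>r\<close> rows of \<open>U\<close> and the first \<open>r\<close>
  columns of \<open>V\<close> cut the leading block out of the Smith form.\<close>

lemma invariant_polys_compress: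
  assumes Q: "Q \<in> carrier_mat m n" and es: "invariant_polys Q es" and r: "r \<le> length es"
  obtains X Y where "X \<in> carrier_mat r m" "Y \<in> carrier_mat n r"
    "X * Q * Y = mat r r (\<lambda>(i,j). if i = j then es ! i else 0)"
proof -
  from es Q obtain U V where U: "U \<in> carrier_mat m m"
    and V: "V \<in> carrier_mat n n" and S: "smith_diag (U * Q * V) es"
    unfolding invariant_polys_def by auto
  define S where "S = U * Q * V"
  have UQ: "U * Q \<in> carrier_mat m n" using U Q by simp
  have Sc: "S \<in> carrier_mat m n" unfolding S_def by (rule mult_carrier_mat[OF UQ V])
  have sd: "smith_diag S es" using S S_def by simp
  then have rmn: "r \<le> m" "r \<le> n" using r Sc by (auto simp: smith_diag_def)
  define X where "X = mat r m (\<lambda>(i,j). U $$ (i,j))"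
  define Y where "Y = mat n r (\<lambda>(i,j). V $$ (i,j))"
  have XY: "X \<in> carrier_mat r m" "Y \<in> carrier_mat n r" by (auto simp: X_def Y_def)
  have XQ: "X * Q \<in> carrier_mat r n" using XY Q by simp
  have rX: "row X i = row U i" if "i < r" for i
    by (rule eq_vecI) (use that rmn U in \<open>auto simp: X_def\<close>)
  have cY: "col Y i = col V i" if "i < r" for i
    by (rule eq_vecI) (use that rmn V in \<open>auto simp: Y_def\<close>)
  have rXQ: "row (X * Q) i = row (U * Q) i" if "i < r" for i
  proof (rule eq_vecI)
    fix j assume "j < dim_vec (row (U * Q) i)"
    then have j: "j < n" using Q by simp
    show "row (X * Q) i $ j = row (U * Q) i $ j"
      using that rmn j XY U Q rX by simp
  qed (use Q in simp)
  have "X * Q * Y = mat r r (\<lambda>(i,j). if i = j then es ! i else 0)"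
  proof (rule eq_matI, goal_cases)
    case (1 i j)
    then have ij: "i < r" "j < r" by auto
    have "(X * Q * Y) $$ (i,j) = row (X * Q) i \<bullet> col Y j"
      by (rule index_mult_mat(1)) (use XQ XY ij in auto)
    also have "\<dots> = row (U * Q) i \<bullet> col V j" using rXQ cY ij by simp
    also have "\<dots> = S $$ (i,j)" unfolding S_def
      by (rule index_mult_mat(1)[symmetric]) (use UQ V ij rmn in auto)
    also have "\<dots> = (if i = j then es ! i else 0)"
      using sd ij rmn r Sc unfolding smith_diag_def by (cases "i = j") auto
    finally show ?case using ij by simp
  qed (use XQ XY in auto)
  then show thesis by (rule that[OF XY])
qed

text \<open>\<open>L\<close> certifies rank at least \<open>r\<close>, so there are at least
  \<open>r\<close> invariant polynomials. Being monic of degree 0, they equal 1, and the leading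
  block is the identity.\<close>

lemma no_finite_eigenvalue_compress:
  assumes P: "P \<in> carrier_mat m n" and nf: "\<not> has_finite_eigenvalue P"
    and L: "L \<in> carrier_mat m r" and rk: "full_col_rank L" and sub: "col_space L \<subseteq> col_space P"
  obtains X Y where "X \<in> carrier_mat r m" "Y \<in> carrier_mat n r" "X * P * Y = 1\<^sub>m r"
proof -
  obtain es where es: "invariant_polys P es" using invariant_polys_exist by blast
  obtain A B where AB: "A \<in> carrier_mat m (length es)" "B \<in> carrier_mat (length es) n" "P = A * B"
    by (rule invariant_polys_factor[OF P es])
  have 1: "1 \<cdot>\<^sub>m P = A * B" unfolding AB(3)[symmetric] by (rule eq_matI) auto
  have r: "r \<le> length es"
    by (rule full_col_rank_le_inner_dim[OF L rk P sub AB(1,2) one_neq_zero 1])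
  obtain X Y where XY: "X \<in> carrier_mat r m" "Y \<in> carrier_mat n r"
    "X * P * Y = mat r r (\<lambda>(i,j). if i = j then es ! i else 0)"
    by (rule invariant_polys_compress[OF P es r])
  have "es ! i = 1" if "i < r" for i
  proof -
    have "degree (es ! i) = 0"
      using nf es that r unfolding has_finite_eigenvalue_def by (metis gr0I nth_mem order_less_le_trans)
    moreover have "lead_coeff (es ! i) = 1"
      using es that r unfolding invariant_polys_def smith_diag_def by auto
    ultimately show ?thesis by (metis degree_0_id one_pCons pCons_eq_iff degree_eq_zeroE coeff_pCons_0)
  qed
  then have "X * P * Y = 1\<^sub>m r" unfolding XY(3) by (intro eq_matI) auto
  then show thesis by (rule that[OF XY(1,2)])
qed

lemma degree_le_mat_degree:
  assumes "i < dim_row A" "j < dim_col A"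
  shows "degree (A $$ (i,j)) \<le> mat_degree A"
proof -
  have "{degree (A $$ (i,j)) | i j. i < dim_row A \<and> j < dim_col A}
      = (\<lambda>(i,j). degree (A $$ (i,j))) ` ({..<dim_row A} \<times> {..<dim_col A})" by auto
  then have "finite {degree (A $$ (i,j)) | i j. i < dim_row A \<and> j < dim_col A}" by simp
  then show ?thesis unfolding mat_degree_def by (intro Max_ge) (use assms in auto)
qed

section \<open>Reversal of polynomials and of matrix factorizations\<close>

lemma coeff_rev_poly: "coeff (rev_poly d p) k = (if k \<le> d then coeff p (d - k) else 0)"
proof -
  have "coeff (rev_poly d p) k = (\<Sum>i\<le>d. if d - i = k then coeff p i else 0)"
    by (simp add: rev_poly_def coeff_sum)
  also have "\<dots> = (\<Sum>i\<le>d. if i = d - k then (if k \<le> d then coeff p i else 0) else 0)"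
    by (rule sum.cong) auto
  finally show ?thesis by simp
qed

lemma rev_poly_reflect:
  assumes "degree p \<le> d"
  shows "rev_poly d p = monom 1 (d - degree p) * reflect_poly p"
proof (rule poly_eqI)
  fix k
  have "coeff p (d - k) = 0" if "k < d - degree p" using that assms by (intro coeff_eq_0) auto
  then show "coeff (rev_poly d p) k = coeff (monom 1 (d - degree p) * reflect_poly p) k"
    using assms by (auto simp: coeff_rev_poly coeff_monom_mult coeff_reflect_poly intro!: arg_cong[of _ _ "coeff p"])
qed

text \<open>Reduces to multiplicativity of \<open>reflect_poly\<close>; the powers of the variable
  by which the bounds exceed the true degrees add up.\<close>

lemma rev_poly_mult:
  assumes "degree p \<le> a" "degree q \<le> b"
  shows "rev_poly (a + b) (p * q) = rev_poly a p * rev_poly b q"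
proof (cases "p = 0 \<or> q = 0")
  case True
  then show ?thesis by (auto simp: rev_poly_def)
next
  case False
  then have "degree (p * q) = degree p + degree q" by (simp add: degree_mult_eq)
  moreover from this have "rev_poly (a + b) (p * q) =
      monom 1 (a + b - (degree p + degree q)) * (reflect_poly p * reflect_poly q)"
    using rev_poly_reflect[of "p * q" "a + b"] assms by (simp add: reflect_poly_mult)
  moreover have "a + b - (degree p + degree q) = (a - degree p) + (b - degree q)"
    using assms by simp
  moreover have "monom (1::'a) ((a - degree p) + (b - degree q)) =
      monom 1 (a - degree p) * monom 1 (b - degree q)"
    by (simp add: mult_monom)
  ultimately show ?thesis
    unfolding rev_poly_reflect[OF assms(1)] rev_poly_reflect[OF assms(2)]
    by (simp only: mult_ac)
qed

lemma rev_poly_sum: "rev_poly d (\<Sum>i\<in>I. f i) = (\<Sum>i\<in>I. rev_poly d (f i))"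
  by (rule poly_eqI) (simp add: coeff_rev_poly coeff_sum)

lemma rev_poly_rev_poly:
  assumes "d \<le> N" "degree p \<le> d"
  shows "rev_poly N (rev_poly d p) = monom 1 (N - d) * p"
proof (rule poly_eqI)
  fix k
  have "coeff p (k - (N - d)) = 0" if "\<not> k \<le> N" using that assms by (intro coeff_eq_0) auto
  then show "coeff (rev_poly N (rev_poly d p)) k = coeff (monom 1 (N - d) * p) k"
    using assms by (auto simp: coeff_rev_poly coeff_monom_mult intro!: arg_cong[of _ _ "coeff p"])
qed

text \<open>Reversing each factor with respect to its own degree bound turns a factorization of the
  reversal into one of \<open>P\<close>, up to a power of the variable. The rank bound, which
  concerns \<open>P\<close>, thereby reaches the Smith form of the reversal.\<close>

lemma rev_mat_factor:
  assumes P: "P \<in> carrier_mat m n" and d: "mat_degree P \<le> d"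
    and A: "A \<in> carrier_mat m s" and B: "B \<in> carrier_mat s n" and eq: "rev_mat d P = A * B"
  obtains k A' B' where "A' \<in> carrier_mat m s" "B' \<in> carrier_mat s n" "monom 1 k \<cdot>\<^sub>m P = A' * B'"
proof -
  \<comment> \<open>The summand \<open>d\<close> ensures \<open>d \<le> a + b\<close>, as the double
    reversal with respect to \<open>d\<close> and then \<open>a + b\<close> requires.\<close>
  define a where "a = mat_degree A + d"
  define b where "b = mat_degree B"
  define A' where "A' = map_mat (rev_poly a) A"
  define B' where "B' = map_mat (rev_poly b) B"
  have c: "A' \<in> carrier_mat m s" "B' \<in> carrier_mat s n" using A B by (auto simp: A'_def B'_def)
  have dN: "d \<le> a + b" by (simp add: a_def)
  have "monom 1 (a + b - d) \<cdot>\<^sub>m P = A' * B'"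
  proof (rule eq_matI)
    fix i j assume "i < dim_row (A' * B')" "j < dim_col (A' * B')"
    then have ij: "i < m" "j < n" using c by auto
    have dP: "degree (P $$ (i,j)) \<le> d" using degree_le_mat_degree[of i P j] d ij P by auto
    have dA: "degree (A $$ (i,k)) \<le> a" if "k < s" for k
      using degree_le_mat_degree[of i A k] A ij that by (auto simp: a_def)
    have dB: "degree (B $$ (k,j)) \<le> b" if "k < s" for k
      using degree_le_mat_degree[of k B j] B ij that by (auto simp: b_def)
    have "(monom 1 (a + b - d) \<cdot>\<^sub>m P) $$ (i,j) = rev_poly (a + b) (rev_mat d P $$ (i,j))"
      using ij P by (simp add: rev_mat_def rev_poly_rev_poly[OF dN dP])
    also have "rev_mat d P $$ (i,j) = (\<Sum>k<s. A $$ (i,k) * B $$ (k,j))"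
      unfolding eq using ij A B by (simp add: scalar_prod_def lessThan_atLeast0)
    also have "rev_poly (a + b) \<dots> = (\<Sum>k<s. A' $$ (i,k) * B' $$ (k,j))"
      unfolding rev_poly_sum
      by (rule sum.cong) (use ij A B dA dB in \<open>auto simp: A'_def B'_def rev_poly_mult\<close>)
    also have "\<dots> = (A' * B') $$ (i,j)"
      using ij c by (simp add: scalar_prod_def lessThan_atLeast0)
    finally show "(monom 1 (a + b - d) \<cdot>\<^sub>m P) $$ (i,j) = (A' * B') $$ (i,j)" .
  qed (use c P in auto)
  then show thesis by (rule that[OF c])
qed

text \<open>The compressed Smith form of the reversal is evaluated at 0. The constant term of the
  reversal is the coefficient of \<open>P\<close> at \<open>d\<close>, and the diagonal values are
  nonzero, so the diagonal matrix \<open>I\<close> inverts them.\<close>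

lemma no_infinite_eigenvalue_compress:
  assumes P: "P \<in> carrier_mat m n" and d: "mat_degree P \<le> d"
    and ni: "\<not> has_infinite_eigenvalue d P"
    and L: "L \<in> carrier_mat m r" and rk: "full_col_rank L" and sub: "col_space L \<subseteq> col_space P"
  obtains X Y where "X \<in> carrier_mat r m" "Y \<in> carrier_mat n r"
    "X * map_mat (\<lambda>p. coeff p d) P * Y = 1\<^sub>m r"
proof -
  let ?Q = "rev_mat d P"
  have Q: "?Q \<in> carrier_mat m n" using P by (simp add: rev_mat_def)
  obtain es where es: "invariant_polys ?Q es" using invariant_polys_exist by blast
  obtain A B where AB: "A \<in> carrier_mat m (length es)" "B \<in> carrier_mat (length es) n" "?Q = A * B"
    by (rule invariant_polys_factor[OF Q es])
  obtain k A' B' where AB': "A' \<in> carrier_mat m (length es)" "B' \<in> carrier_mat (length es) n"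
    "monom 1 k \<cdot>\<^sub>m P = A' * B'"
    by (rule rev_mat_factor[OF P d AB])
  have r: "r \<le> length es"
    by (rule full_col_rank_le_inner_dim[OF L rk P sub AB'(1,2) _ AB'(3)]) simp
  obtain X Y where XY: "X \<in> carrier_mat r m" "Y \<in> carrier_mat n r"
    "X * ?Q * Y = mat r r (\<lambda>(i,j). if i = j then es ! i else 0)"
    by (rule invariant_polys_compress[OF Q es r])
  interpret h: comm_ring_hom "\<lambda>p::'a poly. poly p 0" by unfold_locales auto
  let ?h = "map_mat (\<lambda>p. poly p 0)"
  have e: "poly (es ! i) 0 \<noteq> 0" if "i < r" for i
    using ni es that r unfolding has_infinite_eigenvalue_def by (metis nth_mem order_less_le_trans)
  define I where "I = mat r r (\<lambda>(i,j). if i = j then inverse (poly (es ! i) 0) else 0)"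
  have I: "I \<in> carrier_mat r r" by (simp add: I_def)
  have hX: "?h X \<in> carrier_mat r m" and hY: "?h Y \<in> carrier_mat n r" and hQ: "?h ?Q \<in> carrier_mat m n"
    using XY Q by auto
  have "?h X * ?h ?Q * ?h Y = ?h (X * ?Q * Y)"
    using h.mat_hom_mult[OF XY(1) Q] h.mat_hom_mult[OF mult_carrier_mat[OF XY(1) Q] XY(2)] by simp
  also have "\<dots> = mat r r (\<lambda>(i,j). if i = j then poly (es ! i) 0 else 0)"
    unfolding XY(3) by (rule eq_matI) auto
  finally have 1: "?h X * ?h ?Q * ?h Y = mat r r (\<lambda>(i,j). if i = j then poly (es ! i) 0 else 0)" .
  have "I * mat r r (\<lambda>(i,j). if i = j then poly (es ! i) 0 else 0) = 1\<^sub>m r"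
  proof (rule eq_matI, goal_cases)
    case (1 i j)
    then have ij: "i < r" "j < r" by auto
    have "(I * mat r r (\<lambda>(i,j). if i = j then poly (es ! i) 0 else 0)) $$ (i,j) =
       (\<Sum>k<r. I $$ (i,k) * (if k = j then poly (es ! k) 0 else 0))"
      using ij I by (simp add: scalar_prod_def lessThan_atLeast0)
    also have "\<dots> =
       (\<Sum>k<r. if k = i then (if i = j then inverse (poly (es ! i) 0) * poly (es ! i) 0 else 0) else 0)"
      by (rule sum.cong) (use ij in \<open>auto simp: I_def\<close>)
    also have "\<dots> = (1\<^sub>m r) $$ (i,j)" using ij e by simp
    finally show ?case .
  qed (use I in auto)
  then have 2: "I * (?h X * ?h ?Q * ?h Y) = 1\<^sub>m r" unfolding 1 .
  have "I * (?h X * ?h ?Q * ?h Y) = I * (?h X * ?h ?Q) * ?h Y"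
    by (rule assoc_mult_mat[symmetric, OF I mult_carrier_mat[OF hX hQ] hY])
  also have "I * (?h X * ?h ?Q) = I * ?h X * ?h ?Q"
    by (rule assoc_mult_mat[symmetric, OF I hX hQ])
  finally have "I * ?h X * ?h ?Q * ?h Y = 1\<^sub>m r" using 2 by simp
  moreover have "?h ?Q = map_mat (\<lambda>p. coeff p d) P"
    by (rule eq_matI) (auto simp: rev_mat_def poly_0_coeff_0 coeff_rev_poly)
  ultimately show thesis using that[OF mult_carrier_mat[OF I hX] hY] by simp
qed

section \<open>Minimal bases and column reduced matrices\<close>

lemma finite_col_degrees: "finite {degree (A $$ (i,j)) | i. i < dim_row A}"
proof -
  have "{degree (A $$ (i,j)) | i. i < dim_row A} = (\<lambda>i. degree (A $$ (i,j))) ` {..<dim_row A}"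
    by auto
  then show ?thesis by simp
qed

lemma col_deg_le_iff: "col_deg A j \<le> c \<longleftrightarrow> (\<forall>i < dim_row A. degree (A $$ (i,j)) \<le> c)"
  unfolding col_deg_def using finite_col_degrees[of A j] by (subst Max_le_iff) auto

lemma degree_le_col_deg: "i < dim_row A \<Longrightarrow> degree (A $$ (i,j)) \<le> col_deg A j"
  using col_deg_le_iff[of A j "col_deg A j"] by simp

lemma row_deg_le_iff:
  "i < dim_row A \<Longrightarrow> row_deg A i \<le> c \<longleftrightarrow> (\<forall>j < dim_col A. degree (A $$ (i,j)) \<le> c)"
  by (simp add: row_deg_def col_deg_le_iff)

lemma degree_le_row_deg:
  "i < dim_row A \<Longrightarrow> j < dim_col A \<Longrightarrow> degree (A $$ (i,j)) \<le> row_deg A i"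
  using row_deg_le_iff[of i A "row_deg A i"] by simp

lemma col_deg_le_mat_degree: "j < dim_col A \<Longrightarrow> col_deg A j \<le> mat_degree A"
  by (simp add: col_deg_le_iff degree_le_mat_degree)

text \<open>The leading column coefficient matrix; a zero column of \<open>L\<close>, having
  \<open>col_deg\<close> 0, gives a zero column.\<close>

definition lead_mat :: "'a::field poly mat \<Rightarrow> 'a mat" where
  "lead_mat L = mat (dim_row L) (dim_col L) (\<lambda>(i,j). coeff (L $$ (i,j)) (col_deg L j))"

lemma lead_mat_carrier [simp]: "lead_mat L \<in> carrier_mat m n \<longleftrightarrow> L \<in> carrier_mat m n"
  unfolding lead_mat_def carrier_mat_def by simp

definition col_reduced :: "'a::field poly mat \<Rightarrow> bool" where
  "col_reduced L \<longleftrightarrow>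
     (\<forall>v \<in> carrier_vec (dim_col L). lead_mat L *\<^sub>v v = 0\<^sub>v (dim_row L) \<longrightarrow> v = 0\<^sub>v (dim_col L))"

text \<open>At the extreme exponent only one term of the convolution survives. The alternative
  \<open>q = 0\<close> stands for degree minus infinity, whereas \<open>degree 0\<close> is
  0.\<close>

lemma coeff_mult_at_bound:
  fixes p q :: "'a::comm_semiring_1 poly"
  assumes p: "degree p \<le> a" and q: "q = 0 \<or> a + degree q \<le> D"
  shows "coeff (p * q) D = coeff p a * (if a \<le> D then coeff q (D - a) else 0)"
proof (cases "q = 0")
  case False
  with q have le: "a + degree q \<le> D" by simp
  have "coeff (p * q) D = (\<Sum>i\<le>D. coeff p i * coeff q (D - i))" by (rule coeff_mult)
  also have "\<dots> = (\<Sum>i\<le>D. if i = a then coeff p a * coeff q (D - a) else 0)"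
  proof (rule sum.cong)
    fix i assume "i \<in> {..D}"
    then have i: "i \<le> D" by simp
    show "coeff p i * coeff q (D - i) = (if i = a then coeff p a * coeff q (D - a) else 0)"
    proof (cases i a rule: linorder_cases)
      case less
      then have "coeff q (D - i) = 0" using le i by (intro coeff_eq_0) linarith
      then show ?thesis using less by simp
    next
      case greater
      then have "coeff p i = 0" using p by (intro coeff_eq_0) linarith
      then show ?thesis using greater by simp
    qed simp
  qed simp
  also have "\<dots> = coeff p a * coeff q (D - a)" using le by simp
  finally show ?thesis using le by simp
qed simp

text \<open>The common computation behind the predictable degree property, the lowering of a column
  degree, and the factorization of the top coefficient of \<open>P\<close>.\<close>

lemma coeff_mult_col_deg:
  assumes L: "L \<in> carrier_mat m r" and T: "T \<in> carrier_mat r n" and ij: "i < m" "j < n"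
    and le: "\<And>l. l < r \<Longrightarrow> T $$ (l,j) = 0 \<or> col_deg L l + degree (T $$ (l,j)) \<le> D"
  shows "coeff ((L * T) $$ (i,j)) D =
    (\<Sum>l<r. lead_mat L $$ (i,l) * (if col_deg L l \<le> D then coeff (T $$ (l,j)) (D - col_deg L l) else 0))"
proof -
  have "(L * T) $$ (i,j) = (\<Sum>l<r. L $$ (i,l) * T $$ (l,j))"
    using L T ij by (simp add: scalar_prod_def lessThan_atLeast0)
  then have "coeff ((L * T) $$ (i,j)) D = (\<Sum>l<r. coeff (L $$ (i,l) * T $$ (l,j)) D)"
    by (simp add: coeff_sum)
  also have "\<dots> = (\<Sum>l<r. lead_mat L $$ (i,l) *
      (if col_deg L l \<le> D then coeff (T $$ (l,j)) (D - col_deg L l) else 0))"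
  proof (rule sum.cong)
    fix l assume "l \<in> {..<r}"
    then have l: "l < r" by simp
    show "coeff (L $$ (i,l) * T $$ (l,j)) D = lead_mat L $$ (i,l) *
      (if col_deg L l \<le> D then coeff (T $$ (l,j)) (D - col_deg L l) else 0)"
      using coeff_mult_at_bound[OF _ le[OF l], of "L $$ (i,l)"] degree_le_col_deg[of i L l] L ij l
      by (simp add: lead_mat_def)
  qed simp
  finally show ?thesis .
qed

text \<open>The predictable degree property of column reduced matrices.\<close>
lemma col_reduced_degree_le:
  assumes red: "col_reduced L" and L: "L \<in> carrier_mat m r" and T: "T \<in> carrier_mat r n"
    and k: "k < r" and j: "j < n" and nz: "T $$ (k,j) \<noteq> 0"
  shows "col_deg L k + degree (T $$ (k,j)) \<le> col_deg (L * T) j"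
proof -
  let ?f = "\<lambda>l. col_deg L l + degree (T $$ (l,j))"
  let ?N = "{l. l < r \<and> T $$ (l,j) \<noteq> 0}"
  define D where "D = Max (?f ` ?N)"
  have fin: "finite (?f ` ?N)" and ne: "?f ` ?N \<noteq> {}" using k nz by auto
  have le: "?f l \<le> D" if "l < r" "T $$ (l,j) \<noteq> 0" for l
    unfolding D_def by (rule Max_ge[OF fin]) (use that in auto)
  from Max_in[OF fin ne] obtain l0 where l0: "l0 < r" "T $$ (l0,j) \<noteq> 0" "?f l0 = D"
    unfolding D_def by auto
  \<comment> \<open>\<open>c\<close> collects the coefficients of column \<open>j\<close> of
    \<open>T\<close> that can contribute at degree \<open>D\<close>. It is nonzero at
    \<open>l0\<close>, so \<open>lead_mat L\<close> cannot annihilate it.\<close>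
  define c where "c = vec r (\<lambda>l. if col_deg L l \<le> D then coeff (T $$ (l,j)) (D - col_deg L l) else 0)"
  have c: "c \<in> carrier_vec r" by (simp add: c_def)
  have "c $ l0 = lead_coeff (T $$ (l0,j))" using l0 by (auto simp: c_def)
  then have "c \<noteq> 0\<^sub>v r" using l0 by auto
  then have "lead_mat L *\<^sub>v c \<noteq> 0\<^sub>v m" using red c L unfolding col_reduced_def by auto
  then obtain i where i: "i < m" "(lead_mat L *\<^sub>v c) $ i \<noteq> 0"
    using L by (metis dim_mult_mat_vec carrier_matD(1) lead_mat_carrier eq_vecI index_zero_vec)
  have "coeff ((L * T) $$ (i,j)) D = (\<Sum>l<r. lead_mat L $$ (i,l) * c $ l)"
    by (subst coeff_mult_col_deg[OF L T i(1) j]) (use le in \<open>auto simp: c_def\<close>)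
  also have "\<dots> = (lead_mat L *\<^sub>v c) $ i"
    using L i c by (simp add: scalar_prod_def lessThan_atLeast0 lead_mat_def)
  finally have "D \<le> degree ((L * T) $$ (i,j))" using i by (intro le_degree) simp
  also have "\<dots> \<le> col_deg (L * T) j" by (rule degree_le_col_deg) (use L i in simp)
  finally show ?thesis using le[OF k nz] by simp
qed

lemma poly_col_basis_mult_invertible:
  assumes B: "poly_col_basis S L" and L: "L \<in> carrier_mat m r" and T: "T \<in> carrier_mat r r"
    and T': "T' \<in> carrier_mat r r" and inv: "T * T' = 1\<^sub>m r"
  shows "poly_col_basis S (L * T)"
proof -
  have inv': "T' * T = 1\<^sub>m r" by (rule poly_mat_left_right_inverse[OF T T' inv])
  have fT: "full_col_rank T" by (rule full_col_rankI_left_inverse[OF T T' inv'])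
  have fL: "full_col_rank L" and S: "col_space L = S" using B by (auto simp: poly_col_basis_iff)
  have "v = 0\<^sub>v r" if v: "v \<in> carrier_vec r" "to_frac (L * T) *\<^sub>v v = 0\<^sub>v m" for v
  proof -
    have "to_frac L *\<^sub>v (to_frac T *\<^sub>v v) = 0\<^sub>v m"
      using v(2) unfolding to_frac_mult[OF L T]
      by (subst (asm) assoc_mult_mat_vec[of _ m r _ r]) (use L T v in simp_all)
    from full_col_rankD[OF fL L _ this] have "to_frac T *\<^sub>v v = 0\<^sub>v r" using T v by auto
    from full_col_rankD[OF fT T v(1) this] show ?thesis .
  qed
  then have "full_col_rank (L * T)" using L T unfolding full_col_rank_def by auto
  moreover have "col_space (L * T) \<subseteq> col_space L" by (rule col_space_mult_subset[OF L T])
  moreover have "L * T * T' = L"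
    using assoc_mult_mat[OF L T T'] inv L by simp
  then have "col_space L \<subseteq> col_space (L * T)"
    using col_space_mult_subset[OF mult_carrier_mat[OF L T] T'] by simp
  ultimately show ?thesis using S by (simp add: poly_col_basis_iff)
qed

text \<open>A kernel vector of the leading coefficient matrix yields a column operation that lowers
  one of the column degrees.\<close>
lemma minimal_col_basis_reduced:
  assumes min: "minimal_col_basis L S" and L: "L \<in> carrier_mat m r"
  shows "col_reduced L"
proof (rule ccontr)
  assume "\<not> col_reduced L"
  then obtain v where v: "v \<in> carrier_vec r" "v \<noteq> 0\<^sub>v r" and Lv: "lead_mat L *\<^sub>v v = 0\<^sub>v m"
    using L unfolding col_reduced_def by auto
  let ?l = "col_deg L"
  let ?J = "{j. j < r \<and> v $ j \<noteq> 0}"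
  have J: "finite (?l ` ?J)" "?l ` ?J \<noteq> {}" using v by (auto intro!: eq_vecI)
  \<comment> \<open>Among the columns in the support of \<open>v\<close>, \<open>k\<close> has
    maximal degree, so the exponents in \<open>g\<close> are genuine differences;
    \<open>v $ k\<close> being nonzero makes \<open>T\<close> invertible.\<close>
  from Max_in[OF this] obtain k where k: "k < r" "v $ k \<noteq> 0" "?l k = Max (?l ` ?J)" by auto
  have le: "?l j \<le> ?l k" if "j < r" "v $ j \<noteq> 0" for j
    unfolding k(3) by (rule Max_ge[OF J(1)]) (use that in auto)
  define g where "g i = monom (v $ i) (?l k - ?l i)" for i
  \<comment> \<open>Right multiplication by \<open>T\<close> replaces column \<open>k\<close> of
    \<open>L\<close> by the combination of its columns with coefficients \<open>g i\<close> and
    keeps the others.\<close>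
  define T where "T = mat r r (\<lambda>(i,j). if j = k then g i else if i = j then 1 else 0)"
  define T' where "T' = mat r r (\<lambda>(i,j). if j = k
     then (if i = k then [:inverse (v $ k):] else - Polynomial.smult (inverse (v $ k)) (g i))
     else if i = j then 1 else 0)"
  have T: "T \<in> carrier_mat r r" and T': "T' \<in> carrier_mat r r" by (auto simp: T_def T'_def)
  have gk: "g k = [:v $ k:]" by (simp add: g_def monom_0)
  have "T * T' = 1\<^sub>m r"
  proof (rule eq_matI, goal_cases)
    case (1 i j)
    then have ij: "i < r" "j < r" by auto
    have "(T * T') $$ (i,j) = (\<Sum>l<r. T $$ (i,l) * T' $$ (l,j))"
      using ij T T' by (simp add: scalar_prod_def lessThan_atLeast0)
    also have "\<dots> = (\<Sum>l<r. (if l = k then g i * T' $$ (k,j) else 0)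
        + (if l = i then (if i = k then 0 else T' $$ (i,j)) else 0))"
      by (rule sum.cong) (use ij k in \<open>auto simp: T_def\<close>)
    also have "\<dots> = g i * T' $$ (k,j) + (if i = k then 0 else T' $$ (i,j))"
      using ij k by (simp add: sum.distrib)
    also have "\<dots> = 1\<^sub>m r $$ (i,j)"
      using ij k gk by (auto simp: T'_def)
    finally show ?case .
  qed (use T T' in auto)
  then have basis: "poly_col_basis S (L * T)"
    using min poly_col_basis_mult_invertible[OF _ L T T'] unfolding minimal_col_basis_def by blast
  have dLT: "dim_row (L * T) = m" "dim_col (L * T) = r" using L T by auto
  have other: "col_deg (L * T) j = ?l j" if j: "j < r" "j \<noteq> k" for j
  proof -
    have "(L * T) $$ (i,j) = L $$ (i,j)" if i: "i < m" for i
    proof -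
      have "(L * T) $$ (i,j) = (\<Sum>l<r. L $$ (i,l) * T $$ (l,j))"
        using i j L T by (simp add: scalar_prod_def lessThan_atLeast0)
      also have "\<dots> = (\<Sum>l<r. if l = j then L $$ (i,l) else 0)"
        by (rule sum.cong) (use j in \<open>auto simp: T_def\<close>)
      finally show ?thesis using j by simp
    qed
    then show ?thesis
      unfolding col_deg_def dLT carrier_matD[OF L] by (simp only: cong: rev_conj_cong)
  qed
  \<comment> \<open>At the old degree the coefficient is an entry of \<open>lead_mat L\<close>
    applied to \<open>v\<close>, hence zero; beyond it, the degree bound suffices.\<close>
  have high: "coeff ((L * T) $$ (i,k)) D = 0" if i: "i < m" and D: "?l k \<le> D" for i D
  proof (cases "D = ?l k")
    case True
    have "T $$ (l,k) = 0 \<or> ?l l + degree (T $$ (l,k)) \<le> ?l k" if "l < r" for l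
    proof (cases "v $ l = 0")
      case False
      then show ?thesis using le[OF that False] that k
        by (simp add: T_def g_def degree_monom_eq)
    qed (use that k in \<open>simp add: T_def g_def\<close>)
    from coeff_mult_col_deg[OF L T i k(1) this]
    have "coeff ((L * T) $$ (i,k)) (?l k) = (\<Sum>l<r. lead_mat L $$ (i,l) *
        (if ?l l \<le> ?l k then coeff (T $$ (l,k)) (?l k - ?l l) else 0))" by simp
    also have "\<dots> = (\<Sum>l<r. lead_mat L $$ (i,l) * v $ l)"
      by (rule sum.cong) (use k le in \<open>auto simp: T_def g_def\<close>)
    also have "\<dots> = (lead_mat L *\<^sub>v v) $ i"
      using L i v by (simp add: scalar_prod_def lessThan_atLeast0 lead_mat_def)
    finally show ?thesis using True Lv i by simp
  next
    case False
    have "(L * T) $$ (i,k) = (\<Sum>l<r. L $$ (i,l) * T $$ (l,k))"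
      using i k L T by (simp add: scalar_prod_def lessThan_atLeast0)
    then have "degree ((L * T) $$ (i,k)) \<le> ?l k"
    proof (simp only:, intro degree_sum_le)
      fix l assume "l \<in> {..<r}"
      then have l: "l < r" by simp
      show "degree (L $$ (i,l) * T $$ (l,k)) \<le> ?l k"
      proof (cases "v $ l = 0")
        case False
        have "degree (L $$ (i,l) * T $$ (l,k)) \<le> degree (L $$ (i,l)) + degree (T $$ (l,k))"
          by (rule degree_mult_le)
        also have "\<dots> \<le> ?l l + (?l k - ?l l)"
          using degree_le_col_deg[of i L l] i l k L False
          by (simp add: T_def g_def degree_monom_eq)
        finally show ?thesis using le[OF l False] by simp
      qed (use l k in \<open>simp add: T_def g_def\<close>)
    qed simp
    then show ?thesis using D False by (intro coeff_eq_0) simp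
  qed
  have less: "col_deg (L * T) k < ?l k"
  \<comment> \<open>A column of degree 0 cannot drop further, since \<open>col_deg\<close> is a
    natural number. In that case the new column would be zero, contradicting independence.\<close>
  proof (cases "?l k = 0")
    case True
    have "to_frac (L * T) *\<^sub>v unit_vec r k = 0\<^sub>v m"
    proof (rule eq_vecI)
      fix i assume "i < dim_vec (0\<^sub>v m :: 'a poly fract vec)"
      then have i: "i < m" by simp
      have "(L * T) $$ (i,k) = 0" 
        by (rule poly_eqI, unfold coeff_0, rule high[OF i]) (simp add: True)
      then have "to_frac (L * T) $$ (i,k) = 0" 
        using i k dLT unfolding to_frac_eq by (subst index_map_mat) auto
      then show "(to_frac (L * T) *\<^sub>v unit_vec r k) $ i = 0\<^sub>v m $ i"
        using i k dLT by simp
    qed (use dLT in simp)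
    then have "unit_vec r k = (0\<^sub>v r :: 'a poly fract vec)"
      using full_col_rankD[OF _ mult_carrier_mat[OF L T] unit_vec_carrier] basis
      unfolding poly_col_basis_iff by blast
    then show ?thesis using k(1) by simp
  next
    case False
    have "col_deg (L * T) k \<le> ?l k - 1"
      unfolding col_deg_le_iff dLT
      by (intro allI impI degree_le) (use high in auto)
    then show ?thesis using False by simp
  qed
  have "col_degsum (L * T) < col_degsum L"
    unfolding col_degsum_def dLT carrier_matD[OF L]
  proof (rule sum_strict_mono_ex1)
    show "\<forall>j\<in>{..<r}. col_deg (L * T) j \<le> ?l j"
    proof
      fix j assume "j \<in> {..<r}"
      then show "col_deg (L * T) j \<le> ?l j" using other[of j] less by (cases "j = k") simp_all
    qed
    show "\<exists>j\<in>{..<r}. col_deg (L * T) j < ?l j" using less k(1) by blast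
  qed simp
  moreover have "col_degsum L \<le> col_degsum (L * T)"
    using min basis unfolding minimal_col_basis_def by blast
  ultimately show False by linarith
qed

text \<open>Some summand of the Leibniz formula is nonzero.\<close>

lemma det_nonzero_permutation:
  fixes T :: "'a::comm_ring_1 mat"
  assumes "T \<in> carrier_mat r r" "det T \<noteq> 0"
  obtains p where "p permutes {0..<r}" "\<And>i. i < r \<Longrightarrow> T $$ (i, p i) \<noteq> 0"
proof -
  have "\<exists>p \<in> {p. p permutes {0..<r}}. signof p * (\<Prod>i = 0..<r. T $$ (i, p i)) \<noteq> 0"
    using assms(2) unfolding det_def'[OF assms(1)] by (rule contrapos_np) (auto intro!: sum.neutral)
  then obtain p where p: "p permutes {0..<r}" "signof p * (\<Prod>i = 0..<r. T $$ (i, p i)) \<noteq> 0" by blast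
  have "T $$ (i, p i) \<noteq> 0" if "i < r" for i
  proof
    assume "T $$ (i, p i) = 0"
    then have "(\<Prod>i = 0..<r. T $$ (i, p i)) = 0"
      by (subst prod.remove[of _ i]) (use that in auto)
    with p(2) show False by simp
  qed
  with p(1) that show thesis by blast
qed

text \<open>The left inverse makes the transition matrix \<open>T\<close> to any competing basis
  polynomial. The predictable degree property then compares column degrees along a permutation
  supported on nonzero entries of \<open>T\<close>.\<close>

lemma minimal_col_basisI:
  assumes L: "L \<in> carrier_mat m r" and X: "X \<in> carrier_mat r m" and XL: "X * L = 1\<^sub>m r"
    and red: "col_reduced L" and S: "col_space L = S"
  shows "minimal_col_basis L S"
  unfolding minimal_col_basis_def
proof (intro conjI allI impI)
  have fL: "full_col_rank L" by (rule full_col_rankI_left_inverse[OF L X XL])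
  then show "poly_col_basis S L" using S by (simp add: poly_col_basis_iff)
  fix B assume "poly_col_basis S B"
  then have fB: "full_col_rank B" and BS: "col_space B = col_space L" using S by (auto simp: poly_col_basis_iff)
  let ?r = "dim_col B"
  \<comment> \<open>\<open>poly_col_basis\<close> does not prescribe the number of rows of
    \<open>B\<close>; it is read off from the length of a zero vector in the common space.\<close>
  have "to_frac B *\<^sub>v 0\<^sub>v ?r \<in> col_space B" unfolding col_space_def by auto
  then have "to_frac B *\<^sub>v 0\<^sub>v ?r \<in> carrier_vec m"
    using BS col_space_subset_carrier[OF L] by blast
  from carrier_vecD[OF this] have "dim_row B = m" by simp
  then have B: "B \<in> carrier_mat m ?r" by (rule carrier_matI) (rule refl)
  \<comment> \<open>Trivial factorizations put the rank bound into a form that, used in both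
    directions, shows the two bases to have equally many columns.\<close>
  have one: "1 \<cdot>\<^sub>m A = A * 1\<^sub>m k" if "A \<in> carrier_mat m k" for A :: "'a poly mat" and k
    unfolding right_mult_one_mat[OF that] by (rule eq_matI) auto
  have "r \<le> ?r"
    by (rule full_col_rank_le_inner_dim[OF L fL B equalityD2[OF BS] B one_carrier_mat one_neq_zero
          one[OF B]])
  moreover have "?r \<le> r"
    by (rule full_col_rank_le_inner_dim[OF B fB L equalityD1[OF BS] L one_carrier_mat one_neq_zero
          one[OF L]])
  ultimately have r: "?r = r" by simp
  note B = B[unfolded r]
  define T where "T = X * B"
  have T: "T \<in> carrier_mat r r" using X B by (simp add: T_def)
  \<comment> \<open>\<open>Z\<close> is the transition matrix over the rational functions.
    Multiplying by \<open>X\<close> identifies it with the polynomial matrix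
    \<open>T\<close>.\<close>
  obtain Z where Z: "Z \<in> carrier_mat r r" "to_frac L * Z = to_frac B"
    by (rule col_space_subset_factor[OF B L]) (use BS in auto)
  let ?L = "to_frac L" and ?X = "to_frac X"
  have c: "?L \<in> carrier_mat m r" "?X \<in> carrier_mat r m" using L X by auto
  have "to_frac T = ?X * (?L * Z)" unfolding T_def to_frac_mult[OF X B] Z(2) ..
  also have "\<dots> = (?X * ?L) * Z" by (rule assoc_mult_mat[symmetric, OF c(2,1) Z(1)])
  also have "?X * ?L = 1\<^sub>m r" unfolding to_frac_mult[OF X L, symmetric] XL by (rule to_frac_one)
  finally have TZ: "to_frac T = Z" using Z(1) by simp
  have LT: "L * T = B"
    by (rule to_frac_inj) (simp add: to_frac_mult[OF L T] TZ Z(2))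
  have "det T \<noteq> 0"
  proof
    assume "det T = 0"
    then have "det Z = 0" using det_to_frac[of T] TZ by simp
    then obtain v where v: "v \<in> carrier_vec r" "v \<noteq> 0\<^sub>v r" "Z *\<^sub>v v = 0\<^sub>v r"
      using det_0_iff_vec_prod_zero_field[OF Z(1)] by blast
    have "to_frac B *\<^sub>v v = ?L *\<^sub>v (Z *\<^sub>v v)"
      unfolding Z(2)[symmetric] by (rule assoc_mult_mat_vec[OF c(1) Z(1) v(1)])
    also have "\<dots> = 0\<^sub>v m" unfolding v(3) using c(1) by auto
    finally show False using full_col_rankD[OF fB B v(1)] v(2) by blast
  qed
  \<comment> \<open>Column \<open>i\<close> of \<open>L\<close> really occurs in column
    \<open>p i\<close> of \<open>B\<close>, so its degree is at most that of the latter.\<close>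
  from det_nonzero_permutation[OF T this] obtain p
    where p: "p permutes {0..<r}" "\<And>i. i < r \<Longrightarrow> T $$ (i, p i) \<noteq> 0" by metis
  have pr: "p i < r" if "i < r" for i using permutes_in_image[OF p(1), of i] that by simp
  have "col_degsum L = (\<Sum>i = 0..<r. col_deg L i)" using L by (simp add: col_degsum_def lessThan_atLeast0)
  also have "\<dots> \<le> (\<Sum>i = 0..<r. col_deg B (p i))"
  proof (rule sum_mono)
    fix i assume "i \<in> {0..<r}"
    then have i: "i < r" by simp
    show "col_deg L i \<le> col_deg B (p i)"
      using col_reduced_degree_le[OF red L T i pr[OF i] p(2)[OF i]] LT by simp
  qed
  also have "\<dots> = (\<Sum>j = 0..<r. col_deg B j)"
    using sum.permute[OF p(1), of "col_deg B"] by (simp add: comp_def)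
  also have "\<dots> = col_degsum B" using r by (simp add: col_degsum_def lessThan_atLeast0)
  finally show "col_degsum L \<le> col_degsum B" .
qed

section \<open>Factorizations\<close>

lemma row_factor_minimal:
  fixes P :: "'a::field poly mat"
  assumes P: "P \<in> carrier_mat m n" and deg: "mat_degree P = d"
    and nf: "\<not> has_finite_eigenvalue P" and ni: "\<not> has_infinite_eigenvalue d P"
    and L: "L \<in> carrier_mat m r" and R: "R \<in> carrier_mat r n" and PLR: "P = L * R"
    and min: "minimal_col_basis L (col_space P)"
  shows "minimal_row_basis R (row_space P) \<and> (\<forall>i<r. col_deg L i + row_deg R i = d)"
proof -
  have fL: "full_col_rank L" and SL: "col_space L \<subseteq> col_space P"
    using min by (auto simp: minimal_col_basis_def poly_col_basis_iff)
  have red: "col_reduced L" by (rule minimal_col_basis_reduced[OF min L])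
  obtain X Y where X: "X \<in> carrier_mat r m" and Y: "Y \<in> carrier_mat n r" and XPY: "X * P * Y = 1\<^sub>m r"
    by (rule no_finite_eigenvalue_compress[OF P nf L fL SL])
  have XL: "X * L \<in> carrier_mat r r" and RY: "R * Y \<in> carrier_mat r r" using X Y L R by auto
  have "(X * L) * (R * Y) = 1\<^sub>m r"
    using XPY assoc_mult_mat[OF X L R] assoc_mult_mat[OF XL R Y] by (simp add: PLR)
  then have RYXL: "(R * Y) * (X * L) = 1\<^sub>m r" by (rule poly_mat_left_right_inverse[OF XL RY])
  \<comment> \<open>Regrouping the mutually inverse square matrices \<open>R * Y\<close> and
    \<open>X * L\<close> yields a right inverse \<open>Z\<close> of \<open>R\<close> and a left
    inverse \<open>W\<close> of \<open>L\<close>.\<close>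
  define Z where "Z = Y * (X * L)"
  define W where "W = (R * Y) * X"
  have Z: "Z \<in> carrier_mat n r" unfolding Z_def by (rule mult_carrier_mat[OF Y XL])
  have W: "W \<in> carrier_mat r m" unfolding W_def by (rule mult_carrier_mat[OF RY X])
  have RZ: "R * Z = 1\<^sub>m r"
    using RYXL assoc_mult_mat[OF R Y XL] by (simp add: Z_def)
  have WL: "W * L = 1\<^sub>m r"
    using RYXL assoc_mult_mat[OF RY X L] by (simp add: W_def)
  have WP: "W * P = R"
    using assoc_mult_mat[OF W L R] WL R by (simp add: PLR)
  have le_d: "col_deg L l + degree (R $$ (l,j)) \<le> d" if "l < r" "j < n" "R $$ (l,j) \<noteq> 0" for l j
    using col_reduced_degree_le[OF red L R that] col_deg_le_mat_degree[of j P] P that deg PLR by auto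
  \<comment> \<open>If \<open>col_deg L l\<close> exceeds \<open>d\<close>, then \<open>le_d\<close>
    forces row \<open>l\<close> of \<open>R\<close> to vanish, so the default 0 is the right
    value.\<close>
  define R0 where "R0 = mat r n (\<lambda>(l,j). if col_deg L l \<le> d then coeff (R $$ (l,j)) (d - col_deg L l) else 0)"
  have R0: "R0 \<in> carrier_mat r n" by (simp add: R0_def)
  let ?P = "map_mat (\<lambda>p. coeff p d) P" and ?L = "lead_mat L"
  have Lc: "?L \<in> carrier_mat m r" using L by simp
  have Pd: "?P = ?L * R0"
  proof (rule eq_matI)
    fix i j assume "i < dim_row (?L * R0)" "j < dim_col (?L * R0)"
    then have ij: "i < m" "j < n" using Lc R0 by auto
    have "?P $$ (i,j) = coeff (P $$ (i,j)) d" using ij P by simp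
    also have "P $$ (i,j) = (L * R) $$ (i,j)" unfolding PLR ..
    also have "coeff \<dots> d = (\<Sum>l<r. ?L $$ (i,l) * R0 $$ (l,j))"
      by (subst coeff_mult_col_deg[OF L R ij]) (use le_d ij in \<open>auto simp: R0_def\<close>)
    also have "\<dots> = (?L * R0) $$ (i,j)"
      using ij Lc R0 by (simp add: scalar_prod_def lessThan_atLeast0)
    finally show "?P $$ (i,j) = (?L * R0) $$ (i,j)" .
  qed (use P Lc R0 in auto)
  obtain X0 Y0 where X0: "X0 \<in> carrier_mat r m" and Y0: "Y0 \<in> carrier_mat n r"
    and XPY0: "X0 * ?P * Y0 = 1\<^sub>m r"
    by (rule no_infinite_eigenvalue_compress[OF P _ ni L fL SL]) (use deg in simp)
  have XL0: "X0 * ?L \<in> carrier_mat r r" and RY0: "R0 * Y0 \<in> carrier_mat r r"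
    using X0 Lc R0 Y0 by auto
  have "(X0 * ?L) * (R0 * Y0) = 1\<^sub>m r"
    using XPY0 assoc_mult_mat[OF X0 Lc R0] assoc_mult_mat[OF XL0 R0 Y0] by (simp add: Pd)
  then have RYXL0: "(R0 * Y0) * (X0 * ?L) = 1\<^sub>m r" by (rule mat_mult_left_right_inverse[OF XL0 RY0])
  define Z0 where "Z0 = Y0 * (X0 * ?L)"
  have Z0: "Z0 \<in> carrier_mat n r" unfolding Z0_def by (rule mult_carrier_mat[OF Y0 XL0])
  have RZ0: "R0 * Z0 = 1\<^sub>m r"
    using RYXL0 assoc_mult_mat[OF R0 Y0 XL0] by (simp add: Z0_def)
  have degs: "col_deg L i + row_deg R i = d" if i: "i < r" for i
  proof -
    \<comment> \<open>A nonzero entry in each row of \<open>R0\<close> turns the degree inequality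
      \<open>le_d\<close> into an equality; a zero row would contradict the right invertibility of
      \<open>R0\<close>.\<close>
    have "\<exists>j<n. R0 $$ (i,j) \<noteq> 0"
    proof (rule ccontr)
      assume "\<not> ?thesis"
      then have "row R0 i = 0\<^sub>v n" by (intro eq_vecI) (use R0 i in auto)
      then have "(R0 * Z0) $$ (i,i) = 0" using R0 Z0 i by simp
      then show False using RZ0 i by simp
    qed
    then obtain j where j: "j < n" and nz: "R0 $$ (i,j) \<noteq> 0" by blast
    have l: "col_deg L i \<le> d" and cnz: "coeff (R $$ (i,j)) (d - col_deg L i) \<noteq> 0"
      using nz i j by (auto simp: R0_def split: if_splits)
    have "d - col_deg L i \<le> degree (R $$ (i,j))" by (rule le_degree[OF cnz])
    also have "\<dots> \<le> row_deg R i" by (rule degree_le_row_deg) (use R i j in auto)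
    finally have ge: "d - col_deg L i \<le> row_deg R i" .
    have "degree (R $$ (i,j)) \<le> d - col_deg L i" if "j < n" for j
      using le_d[OF i that] by (cases "R $$ (i,j) = 0") auto
    then have "row_deg R i \<le> d - col_deg L i" using R i by (simp add: row_deg_le_iff)
    with ge l show ?thesis by simp
  qed
  \<comment> \<open>By the degree equalities the exponents used in \<open>R0\<close> are exactly the
    row degrees of \<open>R\<close>, so right invertibility of \<open>R0\<close> means that
    \<open>R\<close> is row reduced.\<close>
  have lead: "lead_mat (transpose_mat R) = transpose_mat R0"
  proof (rule eq_matI)
    fix j i assume "j < dim_row (transpose_mat R0)" "i < dim_col (transpose_mat R0)"
    then have ij: "i < r" "j < n" using R0 by auto
    have "row_deg R i = d - col_deg L i" "col_deg L i \<le> d" using degs[OF ij(1)] by auto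
    then show "lead_mat (transpose_mat R) $$ (j,i) = transpose_mat R0 $$ (j,i)"
      using ij R by (simp add: lead_mat_def R0_def row_deg_def)
  qed (use R R0 in \<open>auto simp: lead_mat_def\<close>)
  have Zt: "transpose_mat Z0 * transpose_mat R0 = 1\<^sub>m r"
    using transpose_mult[OF R0 Z0] RZ0 by simp
  have Rt: "transpose_mat R \<in> carrier_mat n r" using R by simp
  have "v = 0\<^sub>v r" if v: "v \<in> carrier_vec r" "transpose_mat R0 *\<^sub>v v = 0\<^sub>v n" for v
  proof -
    have "v = (transpose_mat Z0 * transpose_mat R0) *\<^sub>v v" unfolding Zt using v by simp
    also have "\<dots> = transpose_mat Z0 *\<^sub>v (transpose_mat R0 *\<^sub>v v)"
      by (rule assoc_mult_mat_vec[of _ r n _ r]) (use Z0 R0 v in auto)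
    also have "\<dots> = 0\<^sub>v r" unfolding v(2) using Z0 by auto
    finally show ?thesis .
  qed
  then have redR: "col_reduced (transpose_mat R)"
    using R unfolding col_reduced_def lead by auto
  \<comment> \<open>The two inclusions of row spaces come from \<open>P = L * R\<close> and
    \<open>R = W * P\<close>.\<close>
  have "transpose_mat P = transpose_mat R * transpose_mat L"
    unfolding PLR by (rule transpose_mult[OF L R])
  then have "col_space (transpose_mat P) \<subseteq> col_space (transpose_mat R)"
    using col_space_mult_subset[OF Rt, of "transpose_mat L" m] L by simp
  moreover have "transpose_mat R = transpose_mat P * transpose_mat W"
    using transpose_mult[OF W P] WP by simp
  then have "col_space (transpose_mat R) \<subseteq> col_space (transpose_mat P)"
    using col_space_mult_subset[of "transpose_mat P" n m "transpose_mat W" r] P W by simp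
  ultimately have "col_space (transpose_mat R) = row_space P" by (simp add: row_space_def)
  moreover have "transpose_mat Z * transpose_mat R = 1\<^sub>m r"
    using transpose_mult[OF R Z] RZ by simp
  ultimately have "minimal_row_basis R (row_space P)"
    unfolding minimal_row_basis_def
    by (intro minimal_col_basisI[OF Rt _ _ redR, of "transpose_mat Z"]) (use Z in auto)
  with degs show ?thesis by blast
qed

section \<open>Transposition, exchanging the roles of the two factors\<close>

lemma smith_diag_transpose: "smith_diag S es \<Longrightarrow> smith_diag (transpose_mat S) es"
  unfolding smith_diag_def by (auto simp: min.commute)

lemma invariant_polys_transpose:
  assumes "invariant_polys (transpose_mat P) es"
  shows "invariant_polys P es"
proof -
  from assms obtain S where S: "unimod_equiv (transpose_mat P) S" "smith_diag S es"
    by (auto simp: invariant_polys_iff)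
  from unimod_equiv_transpose[OF S(1)] smith_diag_transpose[OF S(2)]
  show ?thesis by (auto simp: invariant_polys_iff)
qed

lemma has_finite_eigenvalue_transpose:
  "has_finite_eigenvalue (transpose_mat P) \<Longrightarrow> has_finite_eigenvalue P"
  unfolding has_finite_eigenvalue_def using invariant_polys_transpose by blast

lemma has_infinite_eigenvalue_transpose:
  "has_infinite_eigenvalue d (transpose_mat P) \<Longrightarrow> has_infinite_eigenvalue d P"
proof -
  have "rev_mat d (transpose_mat P) = transpose_mat (rev_mat d P)"
    by (rule eq_matI) (auto simp: rev_mat_def)
  then show "has_infinite_eigenvalue d (transpose_mat P) \<Longrightarrow> has_infinite_eigenvalue d P"
    unfolding has_infinite_eigenvalue_def using invariant_polys_transpose by metis
qed

lemma mat_degree_transpose: "mat_degree (transpose_mat P) = mat_degree P"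
proof -
  have "{degree (transpose_mat P $$ (i,j)) | i j. i < dim_col P \<and> j < dim_row P}
      = {degree (P $$ (i,j)) | i j. i < dim_row P \<and> j < dim_col P}"
    by (auto; metis index_transpose_mat(1))
  then show ?thesis by (simp add: mat_degree_def)
qed

text \<open>The transposed factorization has the transpose of \<open>R\<close> as its left factor,
  so \<open>row_factor_minimal\<close> applies to it.\<close>

lemma col_factor_minimal:
  fixes P :: "'a::field poly mat"
  assumes P: "P \<in> carrier_mat m n" and deg: "mat_degree P = d"
    and nf: "\<not> has_finite_eigenvalue P" and ni: "\<not> has_infinite_eigenvalue d P"
    and L: "L \<in> carrier_mat m r" and R: "R \<in> carrier_mat r n" and PLR: "P = L * R"
    and min: "minimal_row_basis R (row_space P)"
  shows "minimal_col_basis L (col_space P) \<and> (\<forall>i<r. col_deg L i + row_deg R i = d)"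
proof -
  have "minimal_row_basis (transpose_mat L) (row_space (transpose_mat P)) \<and>
      (\<forall>i<r. col_deg (transpose_mat R) i + row_deg (transpose_mat L) i = d)"
  proof (rule row_factor_minimal)
    show "transpose_mat P = transpose_mat R * transpose_mat L"
      unfolding PLR by (rule transpose_mult[OF L R])
    show "minimal_col_basis (transpose_mat R) (col_space (transpose_mat P))"
      using min by (simp add: minimal_row_basis_def row_space_def)
  qed (use assms has_finite_eigenvalue_transpose has_infinite_eigenvalue_transpose in
      \<open>auto simp: mat_degree_transpose\<close>)
  then show ?thesis
    by (simp add: minimal_row_basis_def row_space_def row_deg_def add.commute)
qed

theorem theorem3p21:
  fixes P :: "'a::field poly mat" and m n r d :: nat
  assumes "P \<in> carrier_mat m n"
    and "normal_rank P = r" and "r > 0"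
    and "mat_degree P = d"
    and "\<not> has_finite_eigenvalue P"
    and "\<not> has_infinite_eigenvalue d P"
  shows
   "(\<forall>L E R. L \<in> carrier_mat m r \<and> E \<in> carrier_mat r r \<and> R \<in> carrier_mat r n \<and>
        P = L * E * R \<and> minimal_col_basis L (col_space P) \<and>
        minimal_row_basis R (row_space P) \<and> same_invariant_polys E P \<longrightarrow>
        minimal_row_basis (E * R) (row_space P) \<and>
        minimal_col_basis (L * E) (col_space P) \<and>
        (\<forall>i < r. col_deg L i + row_deg (E * R) i = d \<and>
                 col_deg (L * E) i + row_deg R i = d))
    \<and> (\<forall>L R. L \<in> carrier_mat m r \<and> R \<in> carrier_mat r n \<and> P = L * R \<and>
        minimal_col_basis L (col_space P) \<and> same_invariant_polys R P \<longrightarrow>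
        minimal_row_basis R (row_space P) \<and>
        (\<forall>i < r. col_deg L i + row_deg R i = d))
    \<and> (\<forall>L R. L \<in> carrier_mat m r \<and> R \<in> carrier_mat r n \<and> P = L * R \<and>
        minimal_row_basis R (row_space P) \<and> same_invariant_polys L P \<longrightarrow>
        minimal_col_basis L (col_space P) \<and>
        (\<forall>i < r. col_deg L i + row_deg R i = d))"
proof (intro conjI allI impI; elim conjE)
  note row = row_factor_minimal[OF assms(1,4,5,6)] and col = col_factor_minimal[OF assms(1,4,5,6)]
  {
    fix L E R
    assume L: "L \<in> carrier_mat m r" and E: "E \<in> carrier_mat r r" and R: "R \<in> carrier_mat r n"
      and eq: "P = L * E * R" and minL: "minimal_col_basis L (col_space P)"
      and minR: "minimal_row_basis R (row_space P)"
    \<comment> \<open>Both groupings have inner dimension \<open>r\<close>: \<open>L\<close> is the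
      minimal factor in \<open>L * (E * R)\<close>, and \<open>R\<close> in
      \<open>(L * E) * R\<close>.\<close>
    have eq': "P = L * (E * R)" unfolding eq by (rule assoc_mult_mat[OF L E R])
    note 1 = row[OF L mult_carrier_mat[OF E R] eq' minL]
      and 2 = col[OF mult_carrier_mat[OF L E] R eq minR]
    from 1 show "minimal_row_basis (E * R) (row_space P)" by blast
    from 2 show "minimal_col_basis (L * E) (col_space P)" by blast
    fix i assume "i < r"
    with 1 show "col_deg L i + row_deg (E * R) i = d" by blast
    from \<open>i < r\<close> 2 show "col_deg (L * E) i + row_deg R i = d" by blast
  }
qed (use row_factor_minimal[OF assms(1,4,5,6)] col_factor_minimal[OF assms(1,4,5,6)] in blast)+

end
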